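(* Let $\mathcal A$, $\mathcal B$, $\mathcal C$ be Polish spaces. Let $\mathcal P\subset \wp_I(\mathcal A\times\mathcal B)\times\wp_w(\mathcal A\times\mathcal C)$ be a set of consistent measure pairs, i.e. pairs $(\mu,\nu)$ with $\mu^{\mathcal A}=\nu^{\mathcal A}$, endowed with the subspace topology of the product topology. Define $\varphi:\mathcal P\to\wp_w(\mathcal A\times\mathcal B\times\mathcal C)$ by \[ \varphi(\mu,\nu)(A\times B\times C)=\int_{A\times C}\mu(B\mid a)\,\nu(da,dc) \] for all Borel sets $A\subset\mathcal A$, $B\subset\mathcal B$, $C\subset\mathcal C$. Then $\varphi$ is continuous on $\mathcal P$, and for every $(\mu,\nu)\in\mathcal P$ the conditional independence property $\varphi(\mu,\nu)(db\mid a,c)=\varphi(\mu,\nu)(db\mid a)=\mu(db\mid a)$ holds, i.e. for every Borel $B\subset\mathcal B$, $\varphi(\mu,\nu)(B\mid a,c)=\varphi(\mu,\nu)(B\mid a)=\mu(B\mid a)$ for $\varphi(\mu,\nu)$-almost every $(a,c)$.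
   Context: For a Polish space $\mathcal X$, $\wp(\mathcal X)$ denotes the set of Borel probability measures on $\mathcal X$, and $\wp_w(\mathcal X)$ this set endowed with the weak-* topology, the weakest topology making $\mu\mapsto\int f\,d\mu$ continuous for every bounded continuous $f:\mathcal X\to\mathbb R$ (it is again Polish). For $\mu\in\wp(\mathcal X\times\mathcal Y)$, $\mu^{\mathcal X}$ denotes the marginal on $\mathcal X$ and $\mu(\cdot\mid x)$ a regular conditional distribution on $\mathcal Y$ given $x$, so $x\mapsto\mu(\cdot\mid x)$ is Borel measurable into $\wp_w(\mathcal Y)$ and $\mu(X\times Y)=\int_X\mu(Y\mid x)\mu^{\mathcal X}(dx)$; similarly $\lambda(\cdot\mid a,c)$ denotes the conditional distribution on $\mathcal B$ given $(a,c)$ for $\lambda\in\wp(\mathcal A\times\mathcal B\times\mathcal C)$. Topology of information: for $\mu\in\wp(\mathcal A\times\mathcal B)$ let $\psi(\mu)\in\wp(\mathcal A\times\wp_w(\mathcal B))$ be given by $\psi(\mu)(da,d\zeta)=\delta_{\mu(\cdot\mid a)}(d\zeta)\mu^{\mathcal A}(da)$, i.e. $\psi(\mu)(E)=\mu^{\mathcal A}(\{a:(a,\mu(\cdot\mid a))\in E\})$. The topology of information on $\wp(\mathcal A\times\mathcal B)$ is the coarsest topology making $\psi:\wp(\mathcal A\times\mathcal B)\to\wp_w(\mathcal A\times\wp_w(\mathcal B))$ continuous; $\wp_I(\mathcal A\times\mathcal B)$ denotes $\wp(\mathcal A\times\mathcal B)$ with this topology. Thus $\mu_n\to\mu$ in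 $\wp_I(\mathcal A\times\mathcal B)$ iff $\psi(\mu_n)\to\psi(\mu)$ in the weak-* topology. *)

theory Defs
  imports "HOL-Analysis.Analysis" "HOL-Probability.Probability"
begin

definition borel_of :: "'a topology \<Rightarrow> 'a measure" where
  "borel_of X = sigma (topspace X) {U. openin X U}"

definition probs :: "'a topology \<Rightarrow> 'a measure set" where
  "probs X = {M. sets M = sets (borel_of X) \<and> prob_space M}"

definition weakT :: "'a topology \<Rightarrow> 'a measure topology" where
  "weakT X = topology_generated_by
     {{M \<in> probs X. (\<integral>x. f x \<partial>M) \<in> U} | f U.
        continuous_map X euclideanreal f \<and> bounded (f ` topspace X) \<and> open U}"

definition marg :: "('x::topological_space \<times> 'y::topological_space) measure \<Rightarrow> 'x measure" where
  "marg M = distr M borel fst"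

definition is_rcd :: "('x::topological_space \<times> 'y::topological_space) measure \<Rightarrow> ('x \<Rightarrow> 'y measure) \<Rightarrow> bool" where
  "is_rcd M \<kappa> \<longleftrightarrow>
     \<kappa> \<in> borel \<rightarrow>\<^sub>M borel_of (weakT (euclidean :: 'y topology)) \<and>
     (\<forall>x. \<kappa> x \<in> probs (euclidean :: 'y topology)) \<and>
     (\<forall>X \<in> sets borel. \<forall>Y \<in> sets borel.
        measure M (X \<times> Y) = (LINT x:X|marg M. measure (\<kappa> x) Y))"

definition cond :: "('x::topological_space \<times> 'y::topological_space) measure \<Rightarrow> 'x \<Rightarrow> 'y measure" where
  "cond M = (SOME \<kappa>. is_rcd M \<kappa>)"

definition psi :: "('a::topological_space \<times> 'b::topological_space) measure \<Rightarrow> ('a \<times> 'b measure) measure" where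
  "psi M = distr (marg M) (borel_of (prod_topology euclidean (weakT euclidean))) (\<lambda>a. (a, cond M a))"

definition infoT :: "('a::topological_space \<times> 'b::topological_space) measure topology" where
  "infoT = pullback_topology (probs euclidean) psi
             (weakT (prod_topology euclidean (weakT euclidean)))"

end

theory Submission
  imports Defs
begin

text \<open>By a portmanteau criterion, continuity of \<open>\<phi>\<close> only requires that the mass of every open set is lower
  semicontinuous. Indicators of open subsets of the product are increasing limits of
  \<open>1 - (\<Prod>k<m. 1 - q k)\<close> with \<open>q k\<close> of the form \<open>u(b) * G(a, c)\<close>, so it suffices to treat integrals of such
  functions, which equal the \<open>\<nu>\<close>-integral of \<open>G(a, c)\<close> times the \<open>\<mu>\<close>-conditional expectation of \<open>u\<close>
  given \<open>a\<close>. Replacing the latter by a continuous function \<open>h(a)\<close> costs an error controlled by the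
  topology of information, and the remaining integral of \<open>h(a) * G(a, c)\<close> is weakly continuous in \<open>\<nu>\<close>.
  For the conditional independence, the kernel \<open>cond \<mu>\<close> itself disintegrates \<open>\<phi>(\<mu>, \<nu>)\<close> given \<open>(a, c)\<close>,
  and disintegrations are almost everywhere unique. That \<open>cond\<close> is not a junk value rests on the existence of
  regular conditional distributions on Polish spaces.\<close>

section \<open>Weak topology and its Borel sets\<close>

text \<open>No metric is fixed for \<open>weakT\<close> or \<open>infoT\<close>, so continuity is
  argued at a point along the filter \<open>atin\<close>, for arbitrary domains instead of
  sequences. Testing against product functions alone would not settle it: in general their span is
  not uniformly dense in the bounded continuous functions on a noncompact product. Open sets are
  tested instead, since a one-sided bound survives a supremum of continuous functions. The form
  \<open>1 - (\<Prod>k<m. 1 - q k)\<close> is preferred to the more obvious maximum of the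
  \<open>q k\<close> because it expands into a signed sum of product functions. The grouping of
  \<open>(a, c)\<close> against \<open>b\<close> reflects that only \<open>b\<close> is averaged by
  the kernel. A second obstacle is measurability: \<open>is_rcd\<close> asks for kernels that are
  Borel measurable into \<open>weakT\<close>, whereas kernels are composed and integrated through
  \<open>prob_algebra\<close>, whose sigma-algebra comes from evaluations on sets. The two notions
  are matched through a countable subbase of \<open>weakT\<close>, which also makes
  \<open>psi\<close> amenable to a change of variables.\<close>

lemma space_borel_of [simp]: "space (borel_of X) = topspace X"
  unfolding borel_of_def by (rule space_measure_of) (auto dest: openin_subset)

lemma sets_borel_of: "sets (borel_of X) = sigma_sets (topspace X) {U. openin X U}"
  unfolding borel_of_def by (rule sets_measure_of) (auto dest: openin_subset)

lemma borel_of_euclidean [simp]: "borel_of euclidean = borel"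
  by (simp add: borel_of_def borel_def)

lemma continuous_map_measurable_borel_of:
  assumes "continuous_map X Y f"
  shows "f \<in> borel_of X \<rightarrow>\<^sub>M borel_of Y"
  unfolding borel_of_def[of Y]
proof (rule measurable_measure_of)
  fix U assume "U \<in> {U. openin Y U}"
  then have "openin X (f -` U \<inter> topspace X)"
    using assms by (auto simp: continuous_map_alt)
  then show "f -` U \<inter> space (borel_of X) \<in> sets (borel_of X)"
    by (auto simp: sets_borel_of)
qed (use assms in \<open>auto dest: openin_subset simp: continuous_map_def\<close>)

lemma in_probs_euclidean: "M \<in> probs euclidean \<longleftrightarrow> sets M = sets borel \<and> prob_space M"
  by (simp add: probs_def)

lemma topspace_weakT [simp]: "topspace (weakT X) = probs X"
proof -
  have "probs X = {M \<in> probs X. (\<integral>x. 0 \<partial>M) \<in> (UNIV :: real set)}"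
    by simp
  moreover have "continuous_map X euclideanreal (\<lambda>x. 0)" "bounded ((\<lambda>x. 0 :: real) ` topspace X)"
    by (auto simp: bounded_iff)
  ultimately have "probs X \<in> {{M \<in> probs X. (\<integral>x. f x \<partial>M) \<in> U} | f U.
        continuous_map X euclideanreal f \<and> bounded (f ` topspace X) \<and> open U}"
    by blast
  then show ?thesis
    unfolding weakT_def topology_generated_by_topspace by auto
qed

lemma openin_weakT_basic:
  assumes "continuous_map X euclideanreal f" "bounded (f ` topspace X)" "open U"
  shows "openin (weakT X) {M \<in> probs X. (\<integral>x. f x \<partial>M) \<in> U}"
  unfolding weakT_def using assms by (intro topology_generated_by_Basis) blast

lemma continuous_map_weakT_integral:
  assumes "continuous_map X euclideanreal f" "bounded (f ` topspace X)"
  shows "continuous_map (weakT X) euclideanreal (\<lambda>M. \<integral>x. f x \<partial>M)"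
  using openin_weakT_basic[OF assms] by (auto simp: continuous_map_def)

lemma continuous_map_into_weakT:
  assumes "\<And>p. p \<in> topspace X \<Longrightarrow> \<phi> p \<in> probs Y"
    and "\<And>f. continuous_map Y euclideanreal f \<Longrightarrow> bounded (f ` topspace Y) \<Longrightarrow>
       continuous_map X euclideanreal (\<lambda>p. \<integral>x. f x \<partial>\<phi> p)"
  shows "continuous_map X (weakT Y) \<phi>"
  unfolding weakT_def
proof (rule continuous_on_generated_topo)
  fix U assume "U \<in> {{M \<in> probs Y. (\<integral>x. f x \<partial>M) \<in> U} | f U.
        continuous_map Y euclideanreal f \<and> bounded (f ` topspace Y) \<and> open U}"
  then obtain f V where f: "continuous_map Y euclideanreal f" "bounded (f ` topspace Y)" "open V"
    and U: "U = {M \<in> probs Y. (\<integral>x. f x \<partial>M) \<in> V}" by blast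
  have "\<phi> -` U \<inter> topspace X = {p \<in> topspace X. (\<integral>x. f x \<partial>\<phi> p) \<in> V}"
    using assms(1) by (auto simp: U)
  also have "openin X \<dots>"
    using assms(2)[OF f(1,2)] f(3) by (auto simp: continuous_map_def)
  finally show "openin X (\<phi> -` U \<inter> topspace X)" .
next
  have "\<phi> ` topspace X \<subseteq> topspace (weakT Y)" using assms(1) by auto
  then show "\<phi> ` topspace X \<subseteq> \<Union>{{M \<in> probs Y. (\<integral>x. f x \<partial>M) \<in> U} | f U.
        continuous_map Y euclideanreal f \<and> bounded (f ` topspace Y) \<and> open U}"
    unfolding weakT_def topology_generated_by_topspace .
qed

section \<open>A portmanteau criterion for maps from an arbitrary topology\<close>

lemma eventually_atin_topspace: "x \<in> topspace X \<Longrightarrow> \<forall>\<^sub>F p in atin X x. p \<in> topspace X"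
  unfolding eventually_atin using openin_topspace by blast

text \<open>Counting the integers in \<open>1..m\<close> strictly below \<open>y\<close> rounds
  \<open>y\<close> down by at most 1 as long as \<open>y \<le> m\<close>. The strict comparison
  makes the level sets of a continuous function open; the saturated case \<open>m < y\<close>
  carries the induction.\<close>

lemma sum_threshold_bounds:
  fixes y :: real
  assumes "0 \<le> y"
  shows "(real m < y \<longrightarrow> (\<Sum>i<m. of_bool (real i + 1 < y)) = real m) \<and>
    (y \<le> real m \<longrightarrow> (\<Sum>i<m. of_bool (real i + 1 < y)) \<le> y \<and> y - 1 \<le> (\<Sum>i<m. of_bool (real i + 1 < y)))"
proof (induction m)
  case 0
  then show ?case using assms by auto
next
  case (Suc m)
  show ?case
    using Suc by (cases "real m < y"; cases "real m + 1 < y") auto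
qed

text \<open>The layer-cake sum \<open>(1 / m) * (\<Sum>i<m. measure (\<phi> p) {x. (i + 1) / m < f x})\<close> approximates the
  integral of \<open>f\<close> up to \<open>1 / m\<close> uniformly in \<open>p\<close>, so lower semicontinuity on open sets passes
  to integrals.\<close>

lemma lower_semicontinuous_integral:
  fixes \<phi> :: "'p \<Rightarrow> 'x::topological_space measure" and f :: "'x \<Rightarrow> real"
  assumes prob: "\<And>p. p \<in> topspace X \<Longrightarrow> \<phi> p \<in> probs euclidean"
    and lsc: "\<And>W t. open W \<Longrightarrow> openin X {p \<in> topspace X. t < measure (\<phi> p) W}"
    and f: "continuous_on UNIV f" "\<And>x. 0 \<le> f x" "\<And>x. f x \<le> 1"
    and p0: "p0 \<in> topspace X" and "0 < e"
  shows "\<forall>\<^sub>F p in atin X p0. (\<integral>x. f x \<partial>\<phi> p0) - e < (\<integral>x. f x \<partial>\<phi> p)"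
proof -
  \<comment> \<open>\<open>1 / m < e / 2\<close> pays for the rounding. The other
    \<open>e / 2\<close> is the loss granted to each single level set, which averaging over the
    \<open>m\<close> sets does not enlarge.\<close>
  obtain m where m: "real m > 2 / e" using reals_Archimedean2 by blast
  with \<open>0 < e\<close> have m0: "0 < real m" by (smt (verit) divide_pos_pos)
  define W where "W i = {x. real i + 1 < real m * f x}" for i
  have W: "open (W i)" for i
    unfolding W_def by (intro open_Collect_less continuous_intros f)
  have bound: "(1 / real m) * (\<Sum>i<m. measure (\<phi> p) (W i)) \<le> (\<integral>x. f x \<partial>\<phi> p)"
    "(\<integral>x. f x \<partial>\<phi> p) \<le> (1 / real m) * (\<Sum>i<m. measure (\<phi> p) (W i)) + 1 / real m"
    if p: "p \<in> topspace X" for p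
  proof -
    interpret prob_space "\<phi> p" using prob[OF p] by (simp add: in_probs_euclidean)
    have [measurable_cong, simp]: "sets (\<phi> p) = sets borel"
      using prob[OF p] by (simp add: in_probs_euclidean)
    have [simp]: "space (\<phi> p) = UNIV" using sets_eq_imp_space_eq[of "\<phi> p" borel] by simp
    have [simp]: "measure (\<phi> p) UNIV = 1" using prob_space by simp
    have [measurable]: "f \<in> borel_measurable borel" using f(1) by (rule borel_measurable_continuous_onI)
    have [measurable]: "W i \<in> sets borel" for i using W by simp
    have int: "integrable (\<phi> p) f"
      by (rule integrable_const_bound[of _ 1]) (use f in auto)
    have sum_eq: "(\<Sum>i<m. indicator (W i) x) = (\<Sum>i<m. of_bool (real i + 1 < real m * f x) :: real)" for x
      by (intro sum.cong) (auto simp: W_def)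
    have y: "0 \<le> real m * f x" "real m * f x \<le> real m" for x
      using f(2,3)[of x] m0 by (auto simp: mult_left_le)
    have int2: "integrable (\<phi> p) (\<lambda>x. \<Sum>i<m. indicator (W i) x :: real)"
      by (intro Bochner_Integration.integrable_sum) (auto simp: less_top[symmetric])
    have I: "(\<integral>x. (\<Sum>i<m. indicator (W i) x :: real) \<partial>\<phi> p) = (\<Sum>i<m. measure (\<phi> p) (W i))"
      by (subst Bochner_Integration.integral_sum) (auto simp: less_top[symmetric])
    have "(\<integral>x. (\<Sum>i<m. indicator (W i) x) \<partial>\<phi> p) \<le> (\<integral>x. real m * f x \<partial>\<phi> p)"
      using sum_threshold_bounds[OF y(1)] y(2)
      by (intro integral_mono int2 integrable_mult_right int) (auto simp: sum_eq)
    then show "(1 / real m) * (\<Sum>i<m. measure (\<phi> p) (W i)) \<le> (\<integral>x. f x \<partial>\<phi> p)"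
      using m0 by (simp add: I field_simps)
    have "(\<integral>x. real m * f x - 1 \<partial>\<phi> p) \<le> (\<integral>x. (\<Sum>i<m. indicator (W i) x) \<partial>\<phi> p)"
      using sum_threshold_bounds[OF y(1)] y(2)
      by (intro integral_mono int2 Bochner_Integration.integrable_diff integrable_mult_right int)
         (auto simp: sum_eq)
    also have "(\<integral>x. real m * f x - 1 \<partial>\<phi> p) = real m * (\<integral>x. f x \<partial>\<phi> p) - 1"
      using int by simp
    finally show "(\<integral>x. f x \<partial>\<phi> p) \<le> (1 / real m) * (\<Sum>i<m. measure (\<phi> p) (W i)) + 1 / real m"
      using m0 by (simp add: I field_simps)
  qed
  have "\<forall>\<^sub>F p in atin X p0. measure (\<phi> p0) (W i) - e / 2 < measure (\<phi> p) (W i)" for i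
    unfolding eventually_atin
    using lsc[OF W, of "measure (\<phi> p0) (W i) - e / 2" i] p0 \<open>0 < e\<close>
    by (intro disjI2 exI[of _ "{p \<in> topspace X. measure (\<phi> p0) (W i) - e / 2 < measure (\<phi> p) (W i)}"]) auto
  then have "\<forall>\<^sub>F p in atin X p0. \<forall>i\<in>{..<m}. measure (\<phi> p0) (W i) - e / 2 < measure (\<phi> p) (W i)"
    by (intro eventually_ball_finite) auto
  moreover have "\<forall>\<^sub>F p in atin X p0. p \<in> topspace X"
    using p0 by (rule eventually_atin_topspace)
  ultimately show ?thesis
  proof eventually_elim
    case (elim p)
    have "(\<Sum>i<m. measure (\<phi> p0) (W i) - e / 2) \<le> (\<Sum>i<m. measure (\<phi> p) (W i))"
      using elim by (intro sum_mono) (auto simp: less_imp_le)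
    then have "(\<Sum>i<m. measure (\<phi> p0) (W i)) - real m * (e / 2) \<le> (\<Sum>i<m. measure (\<phi> p) (W i))"
      by (simp add: sum_subtractf)
    then have "(1 / real m) * ((\<Sum>i<m. measure (\<phi> p0) (W i)) - real m * (e / 2)) \<le> (1 / real m) * (\<Sum>i<m. measure (\<phi> p) (W i))"
      using m0 by (intro mult_left_mono) auto
    then have "(1 / real m) * (\<Sum>i<m. measure (\<phi> p0) (W i)) - e / 2 \<le> (1 / real m) * (\<Sum>i<m. measure (\<phi> p) (W i))"
      using m0 by (simp add: right_diff_distrib)
    moreover have "1 / real m < e / 2"
      using m m0 \<open>0 < e\<close> by (simp add: field_simps)
    ultimately show ?case
      using bound(1)[of p] bound(2)[OF p0] elim by linarith
  qed
qed

text \<open>Lower semicontinuity of the integral holds for \<open>f\<close> and for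
  \<open>- f\<close>, after an affine rescaling of each into \<open>[0, 1]\<close>; together these
  give continuity. The criterion is used twice: for the identity map in the construction of a
  countable subbase, and for \<open>\<phi>\<close> itself.\<close>

theorem portmanteau_open:
  fixes \<phi> :: "'p \<Rightarrow> 'x::topological_space measure"
  assumes prob: "\<And>p. p \<in> topspace X \<Longrightarrow> \<phi> p \<in> probs euclidean"
    and lsc: "\<And>W t. open W \<Longrightarrow> openin X {p \<in> topspace X. t < measure (\<phi> p) W}"
  shows "continuous_map X (weakT euclidean) \<phi>"
proof (rule continuous_map_into_weakT[OF prob])
  fix f :: "'x \<Rightarrow> real"
  assume "continuous_map euclidean euclideanreal f" "bounded (f ` topspace euclidean)"
  then have f: "continuous_on UNIV f" and "bounded (range f)" by auto
  then obtain C where C: "\<And>x. \<bar>f x\<bar> \<le> C" by (auto simp: bounded_iff)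
  \<comment> \<open>\<open>C\<close> may be 0, and the rescaling divides by
    \<open>2 * D\<close>.\<close>
  define D where "D = C + 1"
  have D: "0 < D" "\<And>x. \<bar>f x\<bar> \<le> D"
  proof -
    have "0 \<le> C" using C[of undefined] abs_ge_zero[of "f undefined"] by linarith
    then show "0 < D" by (simp add: D_def)
    show "\<bar>f x\<bar> \<le> D" for x using C[of x] by (simp add: D_def)
  qed
  have affine: "(\<integral>x. (D + s * f x) / (2 * D) \<partial>\<phi> p) = (D + s * (\<integral>x. f x \<partial>\<phi> p)) / (2 * D)"
    if p: "p \<in> topspace X" for p s
  proof -
    interpret prob_space "\<phi> p" using prob[OF p] by (simp add: in_probs_euclidean)
    have [measurable_cong, simp]: "sets (\<phi> p) = sets borel"
      using prob[OF p] by (simp add: in_probs_euclidean)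
    have [measurable]: "f \<in> borel_measurable borel" using f(1) by (rule borel_measurable_continuous_onI)
    have [simp]: "measure (\<phi> p) UNIV = 1"
      using prob_space sets_eq_imp_space_eq[of "\<phi> p" borel] by simp
    have "integrable (\<phi> p) f"
      by (rule integrable_const_bound[of _ D]) (use D in auto)
    then show ?thesis using sets_eq_imp_space_eq[of "\<phi> p" borel] by simp
  qed
  \<comment> \<open>The sign \<open>s\<close> is 1 or -1, so one argument serves both the lower and
    the upper estimate.\<close>
  have key: "\<forall>\<^sub>F p in atin X p0. s * (\<integral>x. f x \<partial>\<phi> p0) - e < s * (\<integral>x. f x \<partial>\<phi> p)"
    if p0: "p0 \<in> topspace X" and e: "0 < e" and s: "\<bar>s\<bar> = 1" for p0 e s
  proof -
    have sf: "\<bar>s * f x\<bar> \<le> D" for x using s D by (simp add: abs_mult)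
    have nn: "0 \<le> D + s * f x" "D + s * f x \<le> 2 * D" for x using sf[of x] by linarith+
    have "\<forall>\<^sub>F p in atin X p0. (\<integral>x. (D + s * f x) / (2 * D) \<partial>\<phi> p0) - e / (2 * D)
        < (\<integral>x. (D + s * f x) / (2 * D) \<partial>\<phi> p)"
      using D nn by (intro lower_semicontinuous_integral[OF prob lsc] p0)
        (auto intro!: continuous_intros f e divide_pos_pos simp: divide_le_eq)
    moreover have "\<forall>\<^sub>F p in atin X p0. p \<in> topspace X"
      using p0 by (rule eventually_atin_topspace)
    ultimately show ?thesis
    proof eventually_elim
      case (elim p)
      have "(D + s * (\<integral>x. f x \<partial>\<phi> p0) - e) / (2 * D) < (D + s * (\<integral>x. f x \<partial>\<phi> p)) / (2 * D)"
        using elim(1) unfolding affine[OF p0] affine[OF elim(2)] by (simp add: diff_divide_distrib)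
      then show ?case
        using D(1) by (simp add: divide_less_cancel)
    qed
  qed
  show "continuous_map X euclideanreal (\<lambda>p. \<integral>x. f x \<partial>\<phi> p)"
    unfolding continuous_map_atin limitin_canonical_iff
  proof (intro ballI tendstoI)
    fix p0 and e :: real assume p0: "p0 \<in> topspace X" and e: "0 < e"
    show "\<forall>\<^sub>F p in atin X p0. dist (\<integral>x. f x \<partial>\<phi> p) (\<integral>x. f x \<partial>\<phi> p0) < e"
      using eventually_conj[OF key[OF p0 e, of 1] key[OF p0 e, of "-1"]]
      by (auto simp: dist_real_def elim: eventually_mono)
  qed
qed

section \<open>Tent functions and a countable subbase of the weak topology\<close>

text \<open>Lipschitz approximations from below of the indicator of an open \<open>V\<close>. The
  case \<open>V = UNIV\<close> is separate because \<open>infdist\<close> to the empty set is 0 by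
  convention, which would turn the tent into the zero function.\<close>

definition tent :: "'x::metric_space set \<Rightarrow> nat \<Rightarrow> 'x \<Rightarrow> real" where
  "tent V j x = (if V = UNIV then 1 else min 1 (real j * infdist x (- V)))"

lemma tent_range: "0 \<le> tent V j x" "tent V j x \<le> 1"
  by (auto simp: tent_def infdist_nonneg)

lemma continuous_on_tent: "continuous_on S (tent V j)"
  unfolding tent_def by (cases "V = UNIV") (auto intro!: continuous_intros)

lemma tent_eq_0: "x \<notin> V \<Longrightarrow> tent V j x = 0"
  by (auto simp: tent_def)

lemma tent_mono:
  assumes "V \<subseteq> W" "i \<le> j"
  shows "tent V i x \<le> tent W j x"
proof (cases "W = UNIV")
  case True
  then show ?thesis using tent_range(2)[of V i x] by (auto simp: tent_def)
next
  case False
  with assms have "infdist x (- V) \<le> infdist x (- W)"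
    by (intro infdist_mono) auto
  then have "real i * infdist x (- V) \<le> real j * infdist x (- W)"
    using assms by (intro mult_mono) (auto simp: infdist_nonneg)
  with False assms show ?thesis by (auto simp: tent_def)
qed

text \<open>The distance to the closed complement is positive, so a large factor lifts it past 1.
  The value 1 is reached exactly, not only in the limit; later this makes a factor of a product
  vanish.\<close>

lemma tent_eventually_1:
  assumes "open V" "x \<in> V"
  shows "\<exists>k. \<forall>j\<ge>k. tent V j x = 1"
proof (cases "V = UNIV")
  case False
  then have pos: "0 < infdist x (- V)"
    using assms by (intro infdist_pos_not_in_closed) auto
  obtain k where k: "1 / infdist x (- V) < real k" using reals_Archimedean2 by blast
  have "tent V j x = 1" if "k \<le> j" for j
  proof -
    have "1 / infdist x (- V) \<le> real j" using k that by linarith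
    then show ?thesis using pos False by (simp add: tent_def field_simps min_def)
  qed
  then show ?thesis by blast
qed (simp add: tent_def)

text \<open>The subbase consists of the conditions
  \<open>t < (\<integral>x. q x \<partial>M)\<close> with \<open>t\<close> rational and
  \<open>q\<close> a tent over a finite union of basis sets. These sets are weakly open by
  definition; that they generate every weakly open set is the continuity of the identity map, which
  \<open>portmanteau_open\<close> reduces to measures of open sets.\<close>

lemma countable_weak_subbase:
  shows "\<exists>S. countable S \<and> (\<forall>A\<in>S. \<exists>(f :: 'x \<Rightarrow> real) t. A = {M \<in> probs euclidean. t < (\<integral>x. f x \<partial>M)} \<and>
      continuous_on UNIV f \<and> bounded (range f)) \<and>
    weakT (euclidean :: 'x::{metric_space, second_countable_topology} topology) = topology_generated_by S"
proof -
  obtain B0 :: "'x set set" where B0: "countable B0" "topological_basis B0"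
    using ex_countable_basis by blast
  define B where "B = Union ` {F. finite F \<and> F \<subseteq> B0}"
  have "countable B" unfolding B_def
    using countable_Collect_finite_subset[OF B0(1)] by simp
  define Q where "Q = (\<lambda>(V, j). tent V j) ` (B \<times> (UNIV :: nat set))"
  have "countable Q" unfolding Q_def using \<open>countable B\<close> by simp
  have Q: "continuous_on UNIV q" "bounded (range q)" "0 \<le> q x" "q x \<le> 1" if "q \<in> Q" for q x
    using that unfolding Q_def bounded_iff
    by (auto intro!: continuous_on_tent exI[of _ 1] simp: tent_range)
  define H where "H = (\<lambda>(q :: 'x \<Rightarrow> real, t :: real). {M \<in> probs euclidean. t < (\<integral>x. q x \<partial>M)} :: 'x measure set)"
  define S where "S = H ` (Q \<times> \<rat>)"
  have "countable S" unfolding S_def using \<open>countable Q\<close> countable_rat by blast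
  have S: "\<exists>(f :: 'x \<Rightarrow> real) t. A = {M \<in> probs euclidean. t < (\<integral>x. f x \<partial>M)} \<and>
      continuous_on UNIV f \<and> bounded (range f)" if "A \<in> S" for A
  proof -
    from that obtain q t where "q \<in> Q" "A = H (q, t)" unfolding S_def by auto
    then show ?thesis
      using Q(1,2)[of q] by (intro exI[of _ q] exI[of _ t]) (simp add: H_def)
  qed
  have S_weak: "openin (weakT euclidean) A" if A: "A \<in> S" for A
  proof -
    obtain f :: "'x \<Rightarrow> real" and t where A: "A = {M \<in> probs euclidean. t < (\<integral>x. f x \<partial>M)}"
      and "continuous_on UNIV f" "bounded (range f)" using S[OF A] by blast
    then show ?thesis
      using openin_weakT_basic[of euclidean f "{t<..}"] by simp
  qed
  \<comment> \<open>The tent over the empty set is the zero function; with threshold -1 it puts all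
    of \<open>probs euclidean\<close> into the subbase, which gives the generated topology the right
    carrier.\<close>
  have "tent {} 0 \<in> Q" unfolding Q_def B_def by force
  then have "H (tent {} 0, -1) \<in> S" unfolding S_def by auto
  moreover have "H (tent {} 0, -1) = probs euclidean"
  proof -
    have "-1 < (\<integral>x. tent {} 0 x \<partial>M)" for M :: "'x measure"
      by (rule less_le_trans[OF _ Bochner_Integration.integral_nonneg]) (auto simp: tent_range)
    then show ?thesis by (auto simp: H_def)
  qed
  ultimately have top: "topspace (topology_generated_by S) = probs euclidean"
    unfolding topology_generated_by_topspace by (auto simp: S_def H_def)
  have cont: "continuous_map (topology_generated_by S) (weakT euclidean) (\<lambda>M. M)"
  proof (rule portmanteau_open)
    fix W :: "'x set" and t :: real assume W: "open W"
    define Q' where "Q' = {q \<in> Q. \<forall>x. q x \<le> indicator W x}"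
    \<comment> \<open>\<open>measure M W\<close> is the supremum of the integrals of the tents in
      \<open>Q\<close> below the indicator of \<open>W\<close>, and a rational fits between
      \<open>t\<close> and such an integral. This writes the set as a union of subbase
      members.\<close>
    have "{M \<in> probs euclidean. t < measure M W} = \<Union>(H ` (Q' \<times> {r \<in> \<rat>. t \<le> r}))"
    proof (intro equalityI subsetI)
      fix M assume "M \<in> \<Union>(H ` (Q' \<times> {r \<in> \<rat>. t \<le> r}))"
      then obtain q r where q: "q \<in> Q" "\<And>x. q x \<le> indicator W x" and r: "t \<le> r"
        and M: "M \<in> probs euclidean" "r < (\<integral>x. q x \<partial>M)"
        by (auto simp: H_def Q'_def)
      interpret prob_space M using M by (simp add: in_probs_euclidean)
      have [measurable_cong, simp]: "sets M = sets borel" using M by (simp add: in_probs_euclidean)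
      have [simp]: "space M = UNIV" using sets_eq_imp_space_eq[of M borel] by simp
      have [measurable]: "q \<in> borel_measurable borel" "W \<in> sets borel"
        using Q(1)[OF q(1)] W by (auto intro: borel_measurable_continuous_onI)
      have "(\<integral>x. q x \<partial>M) \<le> (\<integral>x. indicator W x \<partial>M)"
        using Q(3,4)[OF q(1)] q(2)
        by (intro integral_mono integrable_const_bound[of _ 1]) (auto simp: indicator_def)
      then show "M \<in> {M \<in> probs euclidean. t < measure M W}"
        using M r by simp
    next
      fix M assume "M \<in> {M \<in> probs euclidean. t < measure M W}"
      then have M: "M \<in> probs euclidean" "t < measure M W" by auto
      interpret prob_space M using M by (simp add: in_probs_euclidean)
      have [measurable_cong, simp]: "sets M = sets borel" using M by (simp add: in_probs_euclidean)
      have [simp]: "space M = UNIV" using sets_eq_imp_space_eq[of M borel] by simp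
      have [measurable]: "W \<in> sets borel" using W by auto
      obtain F where F: "F \<subseteq> B0" "\<Union>F = W"
        using B0(2) W by (auto simp: topological_basis_def)
      have "countable F" using B0(1) F(1) countable_subset by blast
      \<comment> \<open>Only finite unions belong to \<open>B\<close>, so \<open>W\<close> is
        exhausted by the members of \<open>F\<close> numbered below \<open>k\<close>. Using the same
        \<open>k\<close> for the union and for the steepness of the tent gives one sequence;
        \<open>tent_mono\<close> compares it with the tent over a single member containing the
        point.\<close>
      define V where "V k = \<Union>{U \<in> F. to_nat_on F U < k}" for k
      have fin: "finite {U \<in> F. to_nat_on F U < k}" for k
        by (rule inj_on_finite[of "to_nat_on F" _ "{..<k}"])
           (use inj_on_to_nat_on[OF \<open>countable F\<close>] in \<open>auto intro: inj_on_subset\<close>)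
      have V: "V k \<in> B" for k
        unfolding B_def V_def using fin[of k] F(1) by (intro imageI) auto
      have VW: "V k \<subseteq> W" for k using F(2) by (auto simp: V_def)
      define q where "q k = tent (V k) k" for k
      have q: "q k \<in> Q" for k unfolding Q_def q_def using V by auto
      have qW: "q k x \<le> indicator W x" for k x
        using VW[of k] tent_range(2)[of "V k" k x] tent_eq_0[of x "V k" k]
        by (cases "x \<in> V k") (auto simp: q_def indicator_def)
      have [measurable]: "q k \<in> borel_measurable borel" for k
        using Q(1)[OF q] by (intro borel_measurable_continuous_onI)
      have "(\<lambda>k. q k x) \<longlonglongrightarrow> indicator W x" for x
      proof (cases "x \<in> W")
        case True
        then obtain U where U: "U \<in> F" "x \<in> U" using F(2) by auto
        then have "open U" using F(1) B0(2) topological_basis_open by blast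
        from tent_eventually_1[OF this U(2)] obtain k0 where k0: "\<And>j. k0 \<le> j \<Longrightarrow> tent U j x = 1"
          by blast
        have "q k x = 1" if k: "k \<ge> max k0 (Suc (to_nat_on F U))" for k
        proof -
          have "U \<subseteq> V k" using U k by (auto simp: V_def)
          from tent_mono[OF this order_refl, of k x] k0[of k] k tent_range(2)[of "V k" k x]
          show ?thesis by (simp add: q_def)
        qed
        then have "\<forall>\<^sub>F k in sequentially. q k x = indicator W x"
          using True by (intro eventually_sequentiallyI[of "max k0 (Suc (to_nat_on F U))"]) simp
        then show ?thesis by (rule tendsto_eventually)
      next
        case False
        then have "q k x = 0" for k
          using VW[of k] by (auto simp: q_def intro!: tent_eq_0)
        with False show ?thesis by simp
      qed
      then have "(\<lambda>k. \<integral>x. q k x \<partial>M) \<longlonglongrightarrow> (\<integral>x. indicator W x \<partial>M)"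
        by (intro integral_dominated_convergence[where w = "\<lambda>_. 1"])
           (auto simp: Q(3,4)[OF q] abs_of_nonneg)
      then have "(\<lambda>k. \<integral>x. q k x \<partial>M) \<longlonglongrightarrow> measure M W" by simp
      from order_tendstoD(1)[OF this M(2)] obtain k where k: "t < (\<integral>x. q k x \<partial>M)"
        by (auto simp: eventually_sequentially)
      then obtain r where r: "r \<in> \<rat>" "t < r" "r < (\<integral>x. q k x \<partial>M)"
        using Rats_dense_in_real by blast
      then have "M \<in> H (q k, r)" using M by (simp add: H_def)
      moreover have "q k \<in> Q'" using q qW by (simp add: Q'_def)
      ultimately show "M \<in> \<Union>(H ` (Q' \<times> {r \<in> \<rat>. t \<le> r}))"
        using r by (intro UnionI[of "H (q k, r)"]) auto
    qed
    moreover have "openin (topology_generated_by S) (\<Union>(H ` (Q' \<times> {r \<in> \<rat>. t \<le> r})))"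
      by (intro openin_Union) (auto simp: S_def Q'_def intro!: topology_generated_by_Basis)
    ultimately show "openin (topology_generated_by S)
        {p \<in> topspace (topology_generated_by S). t < measure p W}"
      by (simp only: top)
  qed (simp only: top)
  have "openin (weakT euclidean) U = openin (topology_generated_by S) U" for U
  proof
    assume U: "openin (weakT euclidean) U"
    then have "openin (topology_generated_by S) ((\<lambda>M. M) -` U \<inter> probs euclidean)"
      using cont unfolding continuous_map_alt top by blast
    moreover have "U \<subseteq> probs euclidean" using openin_subset[OF U] by simp
    ultimately show "openin (topology_generated_by S) U"
      by (simp add: Int_absorb2)
  next
    assume "openin (topology_generated_by S) U"
    then show "openin (weakT euclidean) U"
      using generate_topology_on_coarsest[of "openin (weakT euclidean)" S U] S_weak
      by (simp add: openin_topology_generated_by_iff)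
  qed
  then have "weakT (euclidean :: 'x topology) = topology_generated_by S"
    by (simp add: topology_eq)
  with \<open>countable S\<close> S show ?thesis by blast
qed

text \<open>\<open>F\<close> is kept nonempty because \<open>\<Inter>{}\<close> is
  \<open>UNIV\<close>, which exceeds the carrier of the weak topology.\<close>

lemma generated_open_base:
  assumes "openin (topology_generated_by S) U" "x \<in> U"
  shows "\<exists>F. finite F \<and> F \<subseteq> S \<and> F \<noteq> {} \<and> x \<in> \<Inter>F \<and> \<Inter>F \<subseteq> U"
proof -
  have "generate_topology_on S U" using assms by (simp add: openin_topology_generated_by_iff)
  then show ?thesis using \<open>x \<in> U\<close>
  proof (induction arbitrary: x)
    case (Int a b)
    then obtain F G where "finite F" "F \<subseteq> S" "F \<noteq> {}" "x \<in> \<Inter>F" "\<Inter>F \<subseteq> a"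
      "finite G" "G \<subseteq> S" "G \<noteq> {}" "x \<in> \<Inter>G" "\<Inter>G \<subseteq> b" by (metis IntE)
    then show ?case by (intro exI[of _ "F \<union> G"]) auto
  next
    case (UN K)
    then obtain k where "k \<in> K" "x \<in> k" by blast
    from UN.IH[OF this] \<open>k \<in> K\<close> show ?case by (meson Union_upper subset_trans)
  next
    case (Basis s)
    then show ?case by (intro exI[of _ "{s}"]) auto
  qed simp
qed

lemma second_countable_generated:
  assumes "countable S"
  shows "second_countable (topology_generated_by S)"
  unfolding second_countable_def
proof (intro exI conjI ballI allI impI)
  let ?B = "Inter ` {F. finite F \<and> F \<subseteq> S \<and> F \<noteq> {}}"
  show "countable ?B"
    by (rule countable_image, rule countable_subset[OF _ countable_Collect_finite_subset[OF assms]]) auto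
  show "openin (topology_generated_by S) V" if "V \<in> ?B" for V
  proof -
    obtain F where F: "finite F" "F \<subseteq> S" "F \<noteq> {}" "V = \<Inter>F" using \<open>V \<in> ?B\<close> by blast
    then show ?thesis
      using topology_generated_by_Basis[of _ S] unfolding F(4) by (intro openin_Inter) blast+
  qed
  fix U x assume "openin (topology_generated_by S) U \<and> x \<in> U"
  then obtain F where "finite F" "F \<subseteq> S" "F \<noteq> {}" "x \<in> \<Inter>F" "\<Inter>F \<subseteq> U"
    using generated_open_base by metis
  then show "\<exists>V\<in>?B. x \<in> V \<and> V \<subseteq> U"
    by (intro bexI[of _ "\<Inter>F"]) auto
qed

section \<open>Borel measurability into second countable topologies\<close>

text \<open>An open set is a union of base members, but only countable unions preserve
  measurability. The Lindelof property of the open subspace extracts a countable subcover, so the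
  base \<open>S\<close> may itself be uncountable, such as all open rectangles.\<close>

lemma second_countable_open_measurable:
  assumes X: "second_countable X" and U: "openin X U"
    and f: "\<And>x. x \<in> space M \<Longrightarrow> f x \<in> topspace X"
    and base: "\<And>V. openin X V \<Longrightarrow> V \<in> S \<Longrightarrow> f -` V \<inter> space M \<in> sets M"
    and S: "\<And>V x. openin X V \<Longrightarrow> x \<in> V \<Longrightarrow> \<exists>W\<in>S. openin X W \<and> x \<in> W \<and> W \<subseteq> V"
  shows "f -` U \<inter> space M \<in> sets M"
proof -
  have "Lindelof_space (subtopology X U)"
    using X by (intro second_countable_imp_Lindelof_space second_countable_subtopology)
  obtain W where W: "W x \<in> S" "openin X (W x)" "x \<in> W x" "W x \<subseteq> U" if "x \<in> U" for x
    using S[OF U] by metis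
  have "U \<subseteq> topspace X" using U by (rule openin_subset)
  have "\<forall>V\<in>W ` U. openin X V" "U \<subseteq> \<Union>(W ` U)" using W by auto
  with \<open>Lindelof_space (subtopology X U)\<close> obtain \<V> where \<V>: "countable \<V>" "\<V> \<subseteq> W ` U" "U \<subseteq> \<Union>\<V>"
    unfolding Lindelof_space_subtopology_subset[OF \<open>U \<subseteq> topspace X\<close>] by meson
  then have "U = \<Union>\<V>" using W(4) by blast
  then have "f -` U \<inter> space M = (\<Union>V\<in>\<V>. f -` V \<inter> space M)" by auto
  also have "\<dots> \<in> sets M"
    using \<V> W by (intro sets.countable_UN'' base) auto
  finally show ?thesis .
qed

text \<open>Needed for the map \<open>\<lambda>a. (a, cond M a)\<close> behind \<open>psi\<close>:
  its target carries the Borel sets of a product topology, which second countability lets one test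
  on open rectangles.\<close>

lemma measurable_Pair_borel_of:
  assumes X: "second_countable X" and Y: "second_countable Y"
    and f: "f \<in> M \<rightarrow>\<^sub>M borel_of X" and g: "g \<in> M \<rightarrow>\<^sub>M borel_of Y"
  shows "(\<lambda>x. (f x, g x)) \<in> M \<rightarrow>\<^sub>M borel_of (prod_topology X Y)"
  unfolding borel_of_def[of "prod_topology X Y"]
proof (rule measurable_measure_of)
  have fg: "f x \<in> topspace X" "g x \<in> topspace Y" if "x \<in> space M" for x
    using measurable_space[OF f that] measurable_space[OF g that] by auto
  then show "(\<lambda>x. (f x, g x)) \<in> space M \<rightarrow> topspace (prod_topology X Y)" by auto
  show "{U. openin (prod_topology X Y) U} \<subseteq> Pow (topspace (prod_topology X Y))"
    using openin_subset by (metis (no_types, lifting) Pow_iff mem_Collect_eq subsetI)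
  fix U assume "U \<in> {U. openin (prod_topology X Y) U}"
  then have U: "openin (prod_topology X Y) U" by simp
  show "(\<lambda>x. (f x, g x)) -` U \<inter> space M \<in> sets M"
  proof (rule second_countable_open_measurable[OF _ U, where S = "{V \<times> W | V W. openin X V \<and> openin Y W}"])
    obtain BX where BX: "countable BX" "\<And>V. V \<in> BX \<Longrightarrow> openin X V"
        "\<And>U x. openin X U \<Longrightarrow> x \<in> U \<Longrightarrow> \<exists>V\<in>BX. x \<in> V \<and> V \<subseteq> U"
      using X unfolding second_countable_def by metis
    obtain BY where BY: "countable BY" "\<And>V. V \<in> BY \<Longrightarrow> openin Y V"
        "\<And>U x. openin Y U \<Longrightarrow> x \<in> U \<Longrightarrow> \<exists>V\<in>BY. x \<in> V \<and> V \<subseteq> U"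
      using Y unfolding second_countable_def by metis
    show "second_countable (prod_topology X Y)"
      unfolding second_countable_def
    proof (intro exI[of _ "(\<lambda>(V, W). V \<times> W) ` (BX \<times> BY)"] conjI ballI allI impI)
      show "countable ((\<lambda>(V, W). V \<times> W) ` (BX \<times> BY))" using BX BY by auto
      show "openin (prod_topology X Y) V" if "V \<in> (\<lambda>(V, W). V \<times> W) ` (BX \<times> BY)" for V
        using that BX BY by (auto simp: openin_prod_Times_iff)
      fix U p assume "openin (prod_topology X Y) U \<and> p \<in> U"
      then obtain V W where VW: "openin X V" "openin Y W" "fst p \<in> V" "snd p \<in> W" "V \<times> W \<subseteq> U"
        unfolding openin_prod_topology_alt by (cases p) force
      obtain V' W' where "V' \<in> BX" "fst p \<in> V'" "V' \<subseteq> V" "W' \<in> BY" "snd p \<in> W'" "W' \<subseteq> W"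
        using BX(3)[OF VW(1,3)] BY(3)[OF VW(2,4)] by blast
      then show "\<exists>V\<in>(\<lambda>(V, W). V \<times> W) ` (BX \<times> BY). p \<in> V \<and> V \<subseteq> U"
        using VW(5) by (intro bexI[of _ "V' \<times> W'"]) (auto simp: mem_Times_iff)
    qed
  next
    fix V assume "V \<in> {V \<times> W | V W. openin X V \<and> openin Y W}"
    then obtain A B where V: "V = A \<times> B" "openin X A" "openin Y B" by blast
    have "(\<lambda>x. (f x, g x)) -` V \<inter> space M = (f -` A \<inter> space M) \<inter> (g -` B \<inter> space M)"
      by (auto simp: V)
    also have "\<dots> \<in> sets M"
      using V by (intro sets.Int measurable_sets[OF f] measurable_sets[OF g]) (auto simp: sets_borel_of)
    finally show "(\<lambda>x. (f x, g x)) -` V \<inter> space M \<in> sets M" .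
  next
    fix V p assume V: "openin (prod_topology X Y) V" "p \<in> V"
    then obtain A B where "openin X A" "openin Y B" "fst p \<in> A" "snd p \<in> B" "A \<times> B \<subseteq> V"
      unfolding openin_prod_topology_alt by (cases p) force
    then show "\<exists>W\<in>{V \<times> W | V W. openin X V \<and> openin Y W}. openin (prod_topology X Y) W \<and> p \<in> W \<and> W \<subseteq> V"
      by (intro bexI[of _ "A \<times> B"]) (auto simp: openin_prod_Times_iff mem_Times_iff)
  qed (use fg in auto)
qed

lemma second_countable_weakT:
  "second_countable (weakT (euclidean :: 'x::{metric_space, second_countable_topology} topology))"
proof -
  obtain S where "countable S" "weakT (euclidean :: 'x topology) = topology_generated_by S"
    using countable_weak_subbase[where 'x = 'x] by blast
  then show ?thesis by (simp add: second_countable_generated)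
qed

lemma second_countable_euclidean:
  "second_countable (euclidean :: 'x::second_countable_topology topology)"
proof -
  obtain B :: "'x set set" where B: "countable B" "topological_basis B"
    using ex_countable_basis by blast
  then show ?thesis
    unfolding second_countable_def
    using topological_basis_open[OF B(2)] topological_basisE[OF B(2)]
    by (intro exI[of _ B]) (metis open_openin)
qed

text \<open>From left to right, the mass of an open set is a limit of integrals of tents, which are
  weakly continuous. From right to left, each subbase member is a condition on one integral, a
  measurable function of a kernel, and countability passes from the subbase to all weakly open sets.
  This opens the calculus of kernels to \<open>cond\<close>.\<close>

lemma measurable_weakT_iff_prob_algebra:
  fixes \<kappa> :: "'a \<Rightarrow> 'x::{metric_space, second_countable_topology} measure"
  shows "\<kappa> \<in> M \<rightarrow>\<^sub>M borel_of (weakT euclidean) \<longleftrightarrow> \<kappa> \<in> M \<rightarrow>\<^sub>M prob_algebra borel"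
proof
  assume k: "\<kappa> \<in> M \<rightarrow>\<^sub>M borel_of (weakT euclidean)"
  have prob: "\<kappa> x \<in> probs euclidean" if "x \<in> space M" for x
    using measurable_space[OF k that] by simp
  show "\<kappa> \<in> M \<rightarrow>\<^sub>M prob_algebra borel"
  proof (rule measurable_prob_algebra_generated[where \<Omega> = UNIV and G = "{W. open W}"])
    fix W :: "'x set" assume "W \<in> {W. open W}"
    then have W: "open W" by simp
    have "(\<lambda>x. emeasure (\<kappa> x) W) \<in> borel_measurable M \<longleftrightarrow>
        (\<lambda>x. ennreal (lim (\<lambda>j. \<integral>y. tent W j y \<partial>\<kappa> x))) \<in> borel_measurable M"
    proof (rule measurable_cong)
      fix x assume x: "x \<in> space M"
      interpret prob_space "\<kappa> x" using prob[OF x] by (simp add: in_probs_euclidean)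
      have [measurable_cong, simp]: "sets (\<kappa> x) = sets borel"
        using prob[OF x] by (simp add: in_probs_euclidean)
      have [simp]: "space (\<kappa> x) = UNIV" using sets_eq_imp_space_eq[of "\<kappa> x" borel] by simp
      have [measurable]: "tent W j \<in> borel_measurable borel" "W \<in> sets borel" for j
        using W by (auto intro: borel_measurable_continuous_onI continuous_on_tent)
      have "(\<lambda>j. tent W j y) \<longlonglongrightarrow> indicator W y" for y
      proof (cases "y \<in> W")
        case True
        then have "\<forall>\<^sub>F j in sequentially. tent W j y = indicator W y"
          using tent_eventually_1[OF W True] by (auto simp: eventually_sequentially)
        then show ?thesis by (rule tendsto_eventually)
      qed (simp add: tent_eq_0)
      then have "(\<lambda>j. \<integral>y. tent W j y \<partial>\<kappa> x) \<longlonglongrightarrow> (\<integral>y. indicator W y \<partial>\<kappa> x)"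
        by (intro integral_dominated_convergence[where w = "\<lambda>_. 1"])
           (auto simp: tent_range abs_of_nonneg)
      from limI[OF this] show "emeasure (\<kappa> x) W = ennreal (lim (\<lambda>j. \<integral>y. tent W j y \<partial>\<kappa> x))"
        by (simp add: emeasure_eq_measure)
    qed
    also have "\<dots>"
    proof -
      have "(\<lambda>x. \<integral>y. tent W j y \<partial>\<kappa> x) \<in> borel_measurable M" for j
      proof -
        have "continuous_map (weakT euclidean) euclideanreal (\<lambda>N. \<integral>y. tent W j y \<partial>N)"
          by (intro continuous_map_weakT_integral)
             (auto simp: continuous_on_tent bounded_iff tent_range intro!: exI[of _ 1])
        from continuous_map_measurable_borel_of[OF this] k show ?thesis
          by (simp add: measurable_compose)
      qed
      then show ?thesis by measurable
    qed
    finally show "(\<lambda>x. emeasure (\<kappa> x) W) \<in> borel_measurable M" .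
  next
    show "sets (borel :: 'x measure) = sigma_sets UNIV {W. open W}" by (simp add: borel_def)
  qed (use prob in \<open>auto simp: in_probs_euclidean Int_stable_def\<close>)
next
  assume k [measurable]: "\<kappa> \<in> M \<rightarrow>\<^sub>M prob_algebra borel"
  obtain S where S: "countable S" "weakT (euclidean :: 'x topology) = topology_generated_by S"
    and S': "\<And>A. A \<in> S \<Longrightarrow> \<exists>(f :: 'x \<Rightarrow> real) t. A = {M \<in> probs euclidean. t < (\<integral>x. f x \<partial>M)} \<and>
      continuous_on UNIV f \<and> bounded (range f)"
    using countable_weak_subbase[where 'x = 'x] by blast
  have prob: "\<kappa> x \<in> probs euclidean" if "x \<in> space M" for x
    using measurable_space[OF k that] by (auto simp: space_prob_algebra in_probs_euclidean)
  have gen: "\<kappa> -` A \<inter> space M \<in> sets M" if "A \<in> S" for A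
  proof -
    obtain f :: "'x \<Rightarrow> real" and t where A: "A = {M \<in> probs euclidean. t < (\<integral>x. f x \<partial>M)}"
      and f: "continuous_on UNIV f" using S'[OF \<open>A \<in> S\<close>] by blast
    have [measurable]: "f \<in> borel_measurable borel" using f by (rule borel_measurable_continuous_onI)
    have [measurable]: "(\<lambda>x. \<integral>y. f y \<partial>\<kappa> x) \<in> borel_measurable M"
      using integral_measurable_subprob_algebra[of f borel] measurable_prob_algebraD[OF k]
      by (simp add: measurable_compose)
    have "\<kappa> -` A \<inter> space M = {x \<in> space M. t < (\<integral>y. f y \<partial>\<kappa> x)}"
      using prob by (auto simp: A)
    also have "\<dots> \<in> sets M" by measurable
    finally show ?thesis .
  qed
  show "\<kappa> \<in> M \<rightarrow>\<^sub>M borel_of (weakT euclidean)"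
    unfolding borel_of_def
  proof (rule measurable_measure_of)
    fix U assume "U \<in> {U. openin (weakT (euclidean :: 'x topology)) U}"
    then have U: "openin (topology_generated_by S) U" by (simp add: S)
    show "\<kappa> -` U \<inter> space M \<in> sets M"
    proof (rule second_countable_open_measurable[OF second_countable_generated[OF S(1)] U,
        where S = "Inter ` {F. finite F \<and> F \<subseteq> S \<and> F \<noteq> {}}"])
      fix V assume "V \<in> Inter ` {F. finite F \<and> F \<subseteq> S \<and> F \<noteq> {}}"
      then obtain F where F: "finite F" "F \<subseteq> S" "F \<noteq> {}" "V = \<Inter>F" by auto
      then have "\<kappa> -` V \<inter> space M = (\<Inter>A\<in>F. \<kappa> -` A \<inter> space M)" by auto
      also have "\<dots> \<in> sets M" using F gen by (intro sets.finite_INT) auto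
      finally show "\<kappa> -` V \<inter> space M \<in> sets M" .
    next
      fix V x assume V: "openin (topology_generated_by S) V" "x \<in> V"
      then obtain F where F: "finite F" "F \<subseteq> S" "F \<noteq> {}" "x \<in> \<Inter>F" "\<Inter>F \<subseteq> V"
        using generated_open_base[OF V] by metis
      moreover have "openin (topology_generated_by S) (\<Inter>F)"
        using F topology_generated_by_Basis[of _ S] by (intro openin_Inter) blast+
      ultimately show "\<exists>W\<in>Inter ` {F. finite F \<and> F \<subseteq> S \<and> F \<noteq> {}}.
          openin (topology_generated_by S) W \<and> x \<in> W \<and> W \<subseteq> V"
        by (intro bexI[of _ "\<Inter>F"]) auto
    next
      show "\<kappa> x \<in> topspace (topology_generated_by S)" if "x \<in> space M" for x
        using prob[OF that] topspace_weakT[of "euclidean :: 'x topology"] by (simp only: S(2))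
    qed
  next
    show "{U. openin (weakT (euclidean :: 'x topology)) U} \<subseteq> Pow (topspace (weakT euclidean))"
      using openin_subset by (metis (no_types, lifting) Pow_iff mem_Collect_eq subsetI)
    show "\<kappa> \<in> space M \<rightarrow> topspace (weakT euclidean)" using prob by simp
  qed
qed

section \<open>Regular conditional distributions\<close>

lemma probsD:
  assumes "M \<in> probs (euclidean :: 'x::topological_space topology)"
  shows "prob_space M" "sets M = sets borel" "space M = UNIV" "measure M UNIV = 1" "emeasure M UNIV = 1"
proof -
  show *: "prob_space M" "sets M = sets borel" using assms by (auto simp: in_probs_euclidean)
  then show **: "space M = UNIV" using sets_eq_imp_space_eq[of M borel] by simp
  interpret prob_space M by fact
  show "measure M UNIV = 1" "emeasure M UNIV = 1"
    using prob_space emeasure_space_1 ** by simp_all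
qed

lemma sets_marg [simp, measurable_cong]: "sets (marg M) = sets borel"
  by (simp add: marg_def)

lemma space_marg [simp]: "space (marg M) = UNIV"
  by (simp add: marg_def)

lemma Times_borel [measurable]:
  fixes X :: "'x::second_countable_topology set" and Y :: "'y::second_countable_topology set"
  assumes "X \<in> sets borel" "Y \<in> sets borel"
  shows "X \<times> Y \<in> sets borel"
  using pair_measureI[OF assms] unfolding borel_prod .

lemma measurable_fst_borel [measurable]:
  "(fst :: 'x::second_countable_topology \<times> 'y::second_countable_topology \<Rightarrow> 'x) \<in> borel \<rightarrow>\<^sub>M borel"
  by (simp flip: borel_prod)

lemma measurable_snd_borel [measurable]:
  "(snd :: 'x::second_countable_topology \<times> 'y::second_countable_topology \<Rightarrow> 'y) \<in> borel \<rightarrow>\<^sub>M borel"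
  by (simp flip: borel_prod)

lemma marg_probs:
  fixes M :: "('x::second_countable_topology \<times> 'y::second_countable_topology) measure"
  assumes "M \<in> probs euclidean"
  shows "marg M \<in> probs euclidean"
proof -
  interpret prob_space M using probsD[OF assms] by simp
  have [measurable_cong]: "sets M = sets borel" using probsD[OF assms] by simp
  show ?thesis unfolding marg_def in_probs_euclidean by (auto intro!: prob_space_distr)
qed

lemma emeasure_marg:
  fixes M :: "('x::second_countable_topology \<times> 'y::second_countable_topology) measure"
  assumes "M \<in> probs euclidean" "X \<in> sets borel"
  shows "emeasure (marg M) X = emeasure M (X \<times> UNIV)"
proof -
  have [measurable_cong]: "sets M = sets borel" using probsD[OF assms(1)] by simp
  have "fst -` X \<inter> space M = X \<times> UNIV" using probsD(3)[OF assms(1)] by auto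
  then show ?thesis unfolding marg_def using assms by (subst emeasure_distr) auto
qed

lemma prob_algebra_probs:
  "\<kappa> \<in> M \<rightarrow>\<^sub>M prob_algebra borel \<Longrightarrow> x \<in> space M \<Longrightarrow> \<kappa> x \<in> probs euclidean"
  using measurable_space[of \<kappa> M "prob_algebra borel" x]
  by (auto simp: space_prob_algebra in_probs_euclidean)

lemma measurable_measure_prob_algebra_kernel:
  assumes "\<kappa> \<in> M \<rightarrow>\<^sub>M prob_algebra N" "Y \<in> sets N"
  shows "(\<lambda>x. measure (\<kappa> x) Y) \<in> borel_measurable M" "(\<lambda>x. emeasure (\<kappa> x) Y) \<in> borel_measurable M"
  using assms measurable_prob_algebraD[OF assms(1)] by measurable

lemma set_integral_kernel:
  assumes \<kappa>: "\<kappa> \<in> borel \<rightarrow>\<^sub>M prob_algebra borel" and m: "m \<in> probs euclidean"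
    and X: "X \<in> sets borel" and Y: "Y \<in> sets borel"
  shows "(\<integral>\<^sup>+x. emeasure (\<kappa> x) Y * indicator X x \<partial>m) = ennreal (LINT x:X|m. measure (\<kappa> x) Y)"
proof -
  interpret m: prob_space m using probsD[OF m] by simp
  note [measurable_cong] = probsD(2)[OF m]
  note [measurable] = measurable_measure_prob_algebra_kernel[OF \<kappa> Y] X
  have fin: "emeasure (\<kappa> x) Y = ennreal (measure (\<kappa> x) Y)" "measure (\<kappa> x) Y \<le> 1" for x
  proof -
    interpret prob_space "\<kappa> x" using probsD(1)[OF prob_algebra_probs[OF \<kappa>]] by simp
    show "emeasure (\<kappa> x) Y = ennreal (measure (\<kappa> x) Y)" "measure (\<kappa> x) Y \<le> 1"
      by (simp_all add: emeasure_eq_measure)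
  qed
  have "(\<integral>\<^sup>+x. emeasure (\<kappa> x) Y * indicator X x \<partial>m) = (\<integral>\<^sup>+x. ennreal (indicator X x *\<^sub>R measure (\<kappa> x) Y) \<partial>m)"
    by (intro nn_integral_cong) (auto simp: fin(1) indicator_def)
  also have "\<dots> = ennreal (LINT x:X|m. measure (\<kappa> x) Y)"
    unfolding set_lebesgue_integral_def
    by (intro nn_integral_eq_integral m.integrable_const_bound[of _ 1])
       (auto simp: fin(2) indicator_def)
  finally show ?thesis .
qed

text \<open>The form with nonnegative integrals suits densities and monotone arguments, where no
  integrability has to be checked.\<close>

lemma is_rcd_iff_emeasure:
  fixes M :: "('x::second_countable_topology \<times> 'y::{metric_space, second_countable_topology}) measure"
  assumes M: "M \<in> probs euclidean"
  shows "is_rcd M \<kappa> \<longleftrightarrow> \<kappa> \<in> borel \<rightarrow>\<^sub>M prob_algebra borel \<and>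
    (\<forall>X\<in>sets borel. \<forall>Y\<in>sets borel.
       emeasure M (X \<times> Y) = (\<integral>\<^sup>+x. emeasure (\<kappa> x) Y * indicator X x \<partial>marg M))"
proof -
  interpret M: prob_space M using probsD[OF M] by simp
  have eq: "measure M (X \<times> Y) = (LINT x:X|marg M. measure (\<kappa> x) Y) \<longleftrightarrow>
     emeasure M (X \<times> Y) = (\<integral>\<^sup>+x. emeasure (\<kappa> x) Y * indicator X x \<partial>marg M)"
    if \<kappa>: "\<kappa> \<in> borel \<rightarrow>\<^sub>M prob_algebra borel" and XY: "X \<in> sets borel" "Y \<in> sets borel" for X Y
  proof -
    have "0 \<le> (LINT x:X|marg M. measure (\<kappa> x) Y)"
      unfolding set_lebesgue_integral_def by (intro Bochner_Integration.integral_nonneg) auto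
    then show ?thesis
      by (simp add: set_integral_kernel[OF \<kappa> marg_probs[OF M] XY] M.emeasure_eq_measure)
  qed
  show ?thesis
    unfolding is_rcd_def measurable_weakT_iff_prob_algebra
    using prob_algebra_probs[of \<kappa> borel] eq by auto
qed

section \<open>Existence of regular conditional distributions\<close>

text \<open>Membership in a set generated by \<open>V 0, ..., V (n - 1)\<close> depends only on the
  trace \<open>F n x\<close>, the indices below \<open>n\<close> whose set contains
  \<open>x\<close>. Hence level \<open>n\<close> has finitely many members, one for each set of
  traces, and the algebra is the union of the levels.\<close>

lemma countable_algebra:
  fixes V :: "nat \<Rightarrow> 'x::topological_space set"
  assumes V: "\<And>i. V i \<in> sets borel"
  shows "\<exists>\<A>. algebra UNIV \<A> \<and> countable \<A> \<and> range V \<subseteq> \<A> \<and> \<A> \<subseteq> sets borel"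
proof -
  define F where "F n x = {i. i < n \<and> x \<in> V i}" for n :: nat and x
  define \<A> where "\<A> = (\<Union>n. (\<lambda>T. F n -` T) ` Pow (Pow {..<n}))"
  \<comment> \<open>Levels increase with \<open>n\<close>: a condition on the trace below
    \<open>n\<close> is one on the trace below \<open>k\<close>. Two members can therefore be
    compared on a common level.\<close>
  have lift: "\<exists>T' \<subseteq> Pow {..<k}. F n -` T = F k -` T'" if "T \<subseteq> Pow {..<n}" "n \<le> k" for n k T
  proof (intro exI[of _ "{S \<in> Pow {..<k}. S \<inter> {..<n} \<in> T}"] conjI)
    have "F n x = F k x \<inter> {..<n}" "F k x \<in> Pow {..<k}" for x using that by (auto simp: F_def)
    then show "F n -` T = F k -` {S \<in> Pow {..<k}. S \<inter> {..<n} \<in> T}" by auto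
  qed auto
  have "algebra UNIV \<A>"
    unfolding algebra_iff_Un
  proof (intro conjI ballI)
    have "F 0 -` {} \<in> \<A>" unfolding \<A>_def by blast
    then show "{} \<in> \<A>" by simp
  next
    fix a assume "a \<in> \<A>"
    then obtain n T where a: "T \<subseteq> Pow {..<n}" "a = F n -` T" unfolding \<A>_def by auto
    have "UNIV - a = F n -` (Pow {..<n} - T)" by (auto simp: a F_def)
    then show "UNIV - a \<in> \<A>" unfolding \<A>_def by blast
  next
    fix a b assume "a \<in> \<A>" "b \<in> \<A>"
    then obtain n T k T' where a: "T \<subseteq> Pow {..<n}" "a = F n -` T" and b: "T' \<subseteq> Pow {..<k}" "b = F k -` T'"
      unfolding \<A>_def by auto
    obtain S S' where "S \<subseteq> Pow {..<max n k}" "a = F (max n k) -` S"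
       "S' \<subseteq> Pow {..<max n k}" "b = F (max n k) -` S'"
      using lift[OF a(1), of "max n k"] lift[OF b(1), of "max n k"] a b by auto
    then have "a \<union> b = F (max n k) -` (S \<union> S')" "S \<union> S' \<in> Pow (Pow {..<max n k})" by auto
    then show "a \<union> b \<in> \<A>" unfolding \<A>_def by blast
  qed simp
  moreover have "countable \<A>" unfolding \<A>_def
  proof (rule countable_UN)
    fix n :: nat
    have "finite (Pow (Pow {..<n}))" by simp
    then show "countable ((\<lambda>T. F n -` T) ` Pow (Pow {..<n}))"
      by (intro countable_image countable_finite)
  qed simp
  moreover have "range V \<subseteq> \<A>"
  proof safe
    fix i
    have "x \<in> V i \<longleftrightarrow> i \<in> F (Suc i) x" "F (Suc i) x \<in> Pow {..<Suc i}" for x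
      by (auto simp: F_def)
    then have eq: "V i = F (Suc i) -` {S \<in> Pow {..<Suc i}. i \<in> S}" by blast
    have "{S \<in> Pow {..<Suc i}. i \<in> S} \<in> Pow (Pow {..<Suc i})" by blast
    then have "F (Suc i) -` {S \<in> Pow {..<Suc i}. i \<in> S} \<in> \<A>" unfolding \<A>_def by blast
    then show "V i \<in> \<A>" by (simp only: eq)
  qed
  moreover have "\<A> \<subseteq> sets borel"
  proof safe
    fix a assume "a \<in> \<A>"
    then obtain n T where a: "T \<subseteq> Pow {..<n}" "a = F n -` T" unfolding \<A>_def by auto
    have "a = (\<Union>S\<in>T. {x \<in> space borel. \<forall>i\<in>{..<n}. x \<in> V i \<longleftrightarrow> i \<in> S})"
    proof (intro set_eqI iffI)
      fix x assume "x \<in> a"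
      then show "x \<in> (\<Union>S\<in>T. {x \<in> space borel. \<forall>i\<in>{..<n}. x \<in> V i \<longleftrightarrow> i \<in> S})"
        unfolding a(2) by (intro UN_I[of "F n x"]) (auto simp: F_def)
    next
      fix x assume "x \<in> (\<Union>S\<in>T. {x \<in> space borel. \<forall>i\<in>{..<n}. x \<in> V i \<longleftrightarrow> i \<in> S})"
      then obtain S where S: "S \<in> T" "\<And>i. i < n \<Longrightarrow> x \<in> V i \<longleftrightarrow> i \<in> S" by auto
      have "F n x = S" using S(2) subsetD[OF a(1) S(1)] by (auto simp: F_def)
      then show "x \<in> a" using S(1) by (simp add: a(2))
    qed
    also have "\<dots> \<in> sets borel"
    proof (intro sets.finite_UN)
      show "finite T" using a(1) finite_subset by auto
      fix S
      note [measurable] = V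
      show "{x \<in> space borel. \<forall>i\<in>{..<n}. x \<in> V i \<longleftrightarrow> i \<in> S} \<in> sets borel" by measurable
    qed
    finally show "a \<in> sets borel" .
  qed
  ultimately show ?thesis by blast
qed

text \<open>Inner approximation by compact sets upgrades finite to countable additivity: if the sets
  decrease to the empty set, finitely many of their compact approximants already have empty
  intersection.\<close>

lemma compact_inner_regular_extension:
  fixes p :: "'x::t2_space set \<Rightarrow> ennreal"
  assumes A': "algebra UNIV \<A>'" and A: "algebra UNIV \<A>" and sub: "\<A> \<subseteq> \<A>'"
    and p1: "p UNIV = 1"
    and add: "\<And>A B. A \<in> \<A>' \<Longrightarrow> B \<in> \<A>' \<Longrightarrow> A \<inter> B = {} \<Longrightarrow> p (A \<union> B) = p A + p B"
    and K: "\<And>A n. A \<in> \<A> \<Longrightarrow> K A n \<in> \<A>' \<and> compact (K A n) \<and> K A n \<subseteq> A"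
    and sup: "\<And>A. A \<in> \<A> \<Longrightarrow> p A = (SUP n::nat. p (K A n))"
  shows "\<exists>\<mu>. sets \<mu> = sigma_sets UNIV \<A> \<and> (\<forall>A\<in>\<A>. emeasure \<mu> A = p A)"
proof -
  interpret A': algebra UNIV \<A>' by fact
  interpret A: algebra UNIV \<A> by fact
  have mono: "p A \<le> p B" if "A \<in> \<A>'" "B \<in> \<A>'" "A \<subseteq> B" for A B
  proof -
    have "p (A \<union> (B - A)) = p A + p (B - A)" using that by (intro add) auto
    then show ?thesis using that by (simp add: Un_absorb1)
  qed
  have le1: "p A \<le> 1" if "A \<in> \<A>'" for A
    using mono[OF that A'.top] p1 by simp
  have "p (UNIV \<union> {}) = p UNIV + p {}" by (intro add) auto
  then have p0: "p {} = 0" using p1 by (simp add: ennreal_add_left_cancel[of 1 0, simplified])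
  define q where "q A = enn2real (p A)" for A
  have pq: "p A = ennreal (q A)" "0 \<le> q A" if "A \<in> \<A>'" for A
    using le1[OF that] unfolding q_def by (auto simp: ennreal_enn2real_if top_unique)
  have qadd: "q (A \<union> B) = q A + q B" if "A \<in> \<A>'" "B \<in> \<A>'" "A \<inter> B = {}" for A B
  proof -
    have "ennreal (q (A \<union> B)) = ennreal (q A + q B)"
      using add[OF that] that pq[of A] pq[of B] pq[of "A \<union> B"] A'.Un[OF that(1,2)] by (simp add: ennreal_plus)
    then show ?thesis
      using pq(2)[of A] pq(2)[of B] pq(2)[of "A \<union> B"] that A'.Un[OF that(1,2)] by (subst (asm) ennreal_inj) auto
  qed
  have qmono: "q A \<le> q B" if "A \<in> \<A>'" "B \<in> \<A>'" "A \<subseteq> B" for A B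
  proof -
    have BA: "B - A \<in> \<A>'" using that(2,1) by (rule A'.Diff)
    have "q (A \<union> (B - A)) = q A + q (B - A)" by (rule qadd[OF that(1) BA]) blast
    moreover have "A \<union> (B - A) = B" using that(3) by blast
    ultimately show ?thesis using pq(2)[OF BA] by simp
  qed
  have qsub: "q (\<Union>i\<in>I. B i) \<le> (\<Sum>i\<in>I. q (B i))" if "finite I" "\<And>i. i \<in> I \<Longrightarrow> B i \<in> \<A>'"
    for I :: "nat set" and B
    using that
  proof (induction I)
    case empty
    then show ?case by (simp add: q_def p0)
  next
    case (insert i I)
    have U: "(\<Union>i\<in>I. B i) \<in> \<A>'" using insert by (intro A'.finite_UN) auto
    have "q (\<Union>i\<in>insert i I. B i) = q (B i \<union> ((\<Union>i\<in>I. B i) - B i))" by (intro arg_cong[of _ _ q]) auto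
    also have "\<dots> = q (B i) + q ((\<Union>i\<in>I. B i) - B i)"
      using insert U by (intro qadd) auto
    also have "q ((\<Union>i\<in>I. B i) - B i) \<le> q (\<Union>i\<in>I. B i)"
      using insert U by (intro qmono) auto
    finally show ?case using insert by auto
  qed
  have approx: "\<exists>n. q A - d < q (K A n)" if "A \<in> \<A>" "0 < d" for A d
  proof (rule ccontr)
    assume "\<not> ?thesis"
    then have le: "q (K A n) \<le> q A - d" for n by (auto simp: not_less)
    have A': "A \<in> \<A>'" using sub that by auto
    have "p (K A n) \<le> ennreal (q A - d)" for n
      using K[OF that(1), of n] le[of n] by (simp add: pq ennreal_leI)
    then have "p A \<le> ennreal (q A - d)" unfolding sup[OF that(1)] by (rule SUP_least)
    moreover have "0 \<le> q A - d" using le[of 0] pq(2)[of "K A 0"] K[OF that(1)] by (meson order_trans)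
    ultimately show False using pq[OF A'] \<open>0 < d\<close> by (simp add: ennreal_le_iff)
  qed
  have "(\<lambda>i. p (A i)) \<longlonglongrightarrow> 0" if A: "range A \<subseteq> \<A>" "decseq A" "(\<Inter>i. A i) = {}" for A
  proof -
    have AA: "A i \<in> \<A>" "A i \<in> \<A>'" for i using A(1) sub by auto
    have "(\<lambda>i. q (A i)) \<longlonglongrightarrow> 0"
    proof (rule LIMSEQ_I)
      fix e :: real assume e: "0 < e"
      \<comment> \<open>Geometric allowances, so that the losses \<open>q (A n - C n)\<close> add up
        to less than \<open>e\<close> however many are needed.\<close>
      have "\<forall>n. \<exists>k. q (A n) - e / 2 ^ Suc n < q (K (A n) k)"
        by (intro allI approx AA(1)) (use e in simp)
      then obtain k where k: "\<And>n. q (A n) - e / 2 ^ Suc n < q (K (A n) (k n))" by metis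
      define C where "C n = K (A n) (k n)" for n
      have C: "C n \<in> \<A>'" "compact (C n)" "C n \<subseteq> A n" for n using K[OF AA(1)] by (auto simp: C_def)
      have "(\<Inter>i. C i) \<subseteq> (\<Inter>i. A i)" using C(3) by (intro INF_mono) blast
      then have "C 0 \<subseteq> (\<Union>i. - C i)" using A(3) by fastforce
      moreover have "open (- C i)" for i using C(2) by (simp add: compact_imp_closed open_Compl)
      ultimately have "\<exists>I. finite I \<and> C 0 \<subseteq> (\<Union>i\<in>I. - C i)"
        using compactE_image[OF C(2)[of 0], of UNIV "\<lambda>i. - C i" "\<exists>I. finite I \<and> C 0 \<subseteq> (\<Union>i\<in>I. - C i)"]
        by auto
      then obtain I where I: "finite I" "C 0 \<subseteq> (\<Union>i\<in>I. - C i)" by blast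
      \<comment> \<open>The element 0 gives \<open>Max\<close> a meaning for empty \<open>I\<close>,
        and accounts for the piece \<open>A 0 - C 0\<close>.\<close>
      define N where "N = Max (insert 0 I)"
      have IN: "i \<le> N" if "i \<in> I" for i using I(1) that by (auto simp: N_def)
      \<comment> \<open>A point of \<open>A N\<close> lies in every earlier \<open>A n\<close>. If
        it lies in \<open>C 0\<close>, the finite subcover makes it miss some \<open>C i\<close>
        with \<open>i \<in> I\<close>; otherwise it already misses \<open>C 0\<close>.\<close>
      have "A N \<subseteq> (\<Union>n\<in>{..N}. A n - C n)"
      proof
        fix x assume x: "x \<in> A N"
        then have xA: "x \<in> A n" if "n \<le> N" for n using A(2) that by (auto simp: decseq_def)
        show "x \<in> (\<Union>n\<in>{..N}. A n - C n)"
        proof (cases "x \<in> C 0")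
          case True
          then obtain i where "i \<in> I" "x \<notin> C i" using I(2) by auto
          then show ?thesis using xA IN by auto
        next
          case False
          then show ?thesis using xA by auto
        qed
      qed
      then have "q (A N) \<le> q (\<Union>n\<in>{..N}. A n - C n)"
        using AA C by (intro qmono A'.finite_UN) auto
      also have "\<dots> \<le> (\<Sum>n\<in>{..N}. q (A n - C n))"
        using AA C by (intro qsub) auto
      also have "\<dots> \<le> (\<Sum>n\<in>{..N}. e / 2 ^ Suc n)"
      proof (intro sum_mono)
        fix n
        have "q (C n \<union> (A n - C n)) = q (C n) + q (A n - C n)" using AA C by (intro qadd) auto
        then show "q (A n - C n) \<le> e / 2 ^ Suc n"
          using k[of n] C(3)[of n] by (simp add: Un_absorb1 C_def)
      qed
      also have "\<dots> < e"
      proof -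
        have "(\<Sum>n\<in>{..k}. e / 2 ^ Suc n) = e - e / 2 ^ Suc k" for k
          by (induction k) (simp_all add: field_simps)
        then show ?thesis using e by simp
      qed
      finally have N: "q (A N) < e" .
      show "\<exists>no. \<forall>n\<ge>no. norm (q (A n) - 0) < e"
      proof (intro exI allI impI)
        fix n assume "N \<le> n"
        then have "q (A n) \<le> q (A N)" using A(2) AA by (intro qmono) (auto simp: decseq_def)
        then show "norm (q (A n) - 0) < e" using N pq(2)[OF AA(2)] by simp
      qed
    qed
    then have "(\<lambda>i. ennreal (q (A i))) \<longlonglongrightarrow> ennreal 0" by (rule tendsto_ennrealI)
    then show ?thesis using pq(1)[OF AA(2)] by simp
  qed
  moreover have "positive \<A> p" using p0 by (simp add: positive_def)
  moreover have "additive \<A> p" using add sub by (auto simp: additive_def)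
  moreover have "p A \<noteq> \<infinity>" if "A \<in> \<A>" for A
    using le1[of A] that sub by (auto simp: top_unique)
  ultimately obtain \<mu> where \<mu>: "\<forall>s\<in>\<A>. \<mu> s = p s" "measure_space UNIV (sigma_sets UNIV \<A>) \<mu>"
    using A.caratheodory_empty_continuous[of p] by auto
  show ?thesis
  proof (intro exI[of _ "measure_of UNIV \<A> \<mu>"] conjI ballI)
    show "sets (measure_of UNIV \<A> \<mu>) = sigma_sets UNIV \<A>" by simp
    fix A assume "A \<in> \<A>"
    then show "emeasure (measure_of UNIV \<A> \<mu>) A = p A"
      using \<mu> by (subst emeasure_measure_of[OF refl]) (auto simp: measure_space_def)
  qed
qed

text \<open>\<open>f B\<close> is a Radon-Nikodym density of the measure sending \<open>X\<close> to
  the mass of \<open>X \<times> B\<close>. It is chosen separately for each \<open>B\<close>, so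
  relations between different \<open>B\<close> hold only off null sets depending on
  \<open>B\<close>.\<close>

lemma conditional_density_exists:
  fixes M :: "('x::second_countable_topology \<times> 'y::second_countable_topology) measure"
  assumes M: "M \<in> probs euclidean"
  shows "\<exists>f. \<forall>B\<in>sets borel. f B \<in> borel_measurable borel \<and>
    (\<forall>X\<in>sets borel. (\<integral>\<^sup>+x\<in>X. f B x \<partial>marg M) = emeasure M (X \<times> B))"
proof -
  interpret M: prob_space M using probsD[OF M] by simp
  interpret m: prob_space "marg M" using probsD[OF marg_probs[OF M]] by simp
  note [measurable_cong, simp] = probsD(2)[OF M]
  have "\<exists>f. f \<in> borel_measurable borel \<and> (\<forall>X\<in>sets borel. (\<integral>\<^sup>+x\<in>X. f x \<partial>marg M) = emeasure M (X \<times> B))"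
    if B [measurable]: "B \<in> sets borel" for B
  proof -
    define N where "N = distr (density M (indicator (UNIV \<times> B))) borel (fst :: 'x \<times> 'y \<Rightarrow> 'x)"
    have N: "emeasure N X = emeasure M (X \<times> B)" if X [measurable]: "X \<in> sets borel" for X
    proof -
      have "emeasure N X = emeasure (density M (indicator (UNIV \<times> B))) (X \<times> UNIV)"
        unfolding N_def by (subst emeasure_distr) (auto simp: probsD(3)[OF M] intro!: arg_cong2[where f = emeasure])
      also have "\<dots> = emeasure M (X \<times> B)"
      proof -
        have "(\<lambda>p. indicator (UNIV \<times> B) p * indicator (X \<times> UNIV) p :: ennreal) = indicator (X \<times> B)"
          by (auto simp: fun_eq_iff split: split_indicator)
        then show ?thesis by (subst emeasure_density) simp_all
      qed
      finally show ?thesis .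
    qed
    have "absolutely_continuous (marg M) N"
      unfolding absolutely_continuous_def
    proof
      fix X assume "X \<in> null_sets (marg M)"
      then have X: "X \<in> sets borel" "emeasure M (X \<times> UNIV) = 0"
        using emeasure_marg[OF M, of X] by (auto simp: null_sets_def)
      then have "emeasure M (X \<times> B) = 0"
        using emeasure_eq_0[of "X \<times> UNIV" M "X \<times> B"] by (simp add: Times_borel Sigma_mono)
      then show "X \<in> null_sets N" using X N by (auto simp: null_sets_def N_def)
    qed
    then obtain f where f: "f \<in> borel_measurable (marg M)" "density (marg M) f = N"
      using m.Radon_Nikodym[of N] by (auto simp: N_def)
    have "(\<integral>\<^sup>+x\<in>X. f x \<partial>marg M) = emeasure M (X \<times> B)" if "X \<in> sets borel" for X
      using that emeasure_density[OF f(1), of X] by (simp add: f(2) N)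
    then show ?thesis using f(1) by (intro exI[of _ f]) simp
  qed
  then have "\<forall>B. \<exists>f. B \<in> sets borel \<longrightarrow> f \<in> borel_measurable borel \<and>
      (\<forall>X\<in>sets borel. (\<integral>\<^sup>+x\<in>X. f x \<partial>marg M) = emeasure M (X \<times> B))" by blast
  from choice[OF this] show ?thesis by blast
qed

text \<open>Over a countable algebra the exceptional null sets of the densities merge into one. Off
  it, \<open>compact_inner_regular_extension\<close> turns \<open>B \<mapsto> f B x\<close> into a
  measure. The identity on rectangles then spreads from the algebra to all Borel sets, since an
  algebra is stable under intersection.\<close>

theorem regular_conditional_distribution_exists:
  fixes M :: "('x::second_countable_topology \<times> 'y::polish_space) measure"
  assumes M: "M \<in> probs euclidean"
  shows "\<exists>\<kappa>. is_rcd M \<kappa>"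
proof -
  interpret M: prob_space M using probsD[OF M] by simp
  interpret m: prob_space "marg M" using probsD[OF marg_probs[OF M]] by simp
  note [measurable_cong, simp] = probsD(2)[OF M]
  note [simp] = probsD(3)[OF M]
  obtain f where f [measurable]: "\<And>B. B \<in> sets borel \<Longrightarrow> f B \<in> borel_measurable borel"
    and fM: "\<And>B X. B \<in> sets borel \<Longrightarrow> X \<in> sets borel \<Longrightarrow> (\<integral>\<^sup>+x\<in>X. f B x \<partial>marg M) = emeasure M (X \<times> B)"
    using conditional_density_exists[OF M] by metis
  have f_unique: "AE x in marg M. f B x = g x"
    if "B \<in> sets borel" "g \<in> borel_measurable borel"
      "\<And>X. X \<in> sets borel \<Longrightarrow> (\<integral>\<^sup>+x\<in>X. g x \<partial>marg M) = emeasure M (X \<times> B)" for B g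
    using that by (intro m.density_unique2) (auto simp: fM)
  obtain B0 :: "'y set set" where B0: "countable B0" "topological_basis B0"
    using ex_countable_basis by blast
  \<comment> \<open>The added \<open>{}\<close> guarantees a nonempty set to enumerate.\<close>
  define V where "V = from_nat_into (insert {} B0)"
  have rangeV: "range V = insert {} B0" unfolding V_def using B0(1) by (intro range_from_nat_into) auto
  have "V i \<in> sets borel" for i
  proof -
    have "V i \<in> insert {} B0" using rangeV by blast
    then show ?thesis using topological_basis_open[OF B0(2)] by auto
  qed
  then obtain \<A> where \<A>: "algebra UNIV \<A>" "countable \<A>" "range V \<subseteq> \<A>" "\<A> \<subseteq> sets borel"
    using countable_algebra by metis
  interpret \<A>: algebra UNIV \<A> by fact
  have "B0 \<subseteq> \<A>" using \<A>(3) rangeV by auto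
  have sigma: "sets (borel :: 'y measure) = sigma_sets UNIV \<A>"
  proof
    have "sets (borel :: 'y measure) = sigma_sets UNIV B0"
      unfolding borel_eq_countable_basis[OF B0] by simp
    also have "\<dots> \<subseteq> sigma_sets UNIV \<A>" using \<open>B0 \<subseteq> \<A>\<close> by (rule sigma_sets_mono')
    finally show "sets (borel :: 'y measure) \<subseteq> sigma_sets UNIV \<A>" .
    show "sigma_sets UNIV \<A> \<subseteq> sets borel"
      using sets.sigma_sets_subset[OF \<A>(4)] by simp
  qed
  define N where "N = distr M borel snd"
  have N: "emeasure N B = emeasure M (UNIV \<times> B)" if "B \<in> sets borel" for B
    unfolding N_def using that by (subst emeasure_distr) (auto intro!: arg_cong2[where f = emeasure])
  have [simp]: "sets N = sets borel" by (simp add: N_def)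
  \<comment> \<open>Inner regularity of the second marginal \<open>N\<close>; this is where
    completeness of \<open>'y\<close> enters. The approximants are chosen once for \<open>N\<close>,
    hence independently of \<open>x\<close>.\<close>
  have ex_compact: "\<exists>C. compact C \<and> C \<subseteq> A \<and> emeasure M (UNIV \<times> A) \<le> emeasure M (UNIV \<times> C) + ennreal (1 / Suc n)"
    if A: "A \<in> sets borel" for A :: "'y set" and n
  proof -
    have fin: "emeasure N (space N) \<noteq> \<infinity>"
      by (simp add: N_def emeasure_distr M.emeasure_space_1)
    have eq: "emeasure N A = (SUP C\<in>{C. C \<subseteq> A \<and> compact C}. emeasure N C)"
      by (rule inner_regular[OF _ fin A]) simp
    have "\<exists>C\<in>{C. C \<subseteq> A \<and> compact C}. emeasure N A < emeasure N C + ennreal (1 / Suc n)"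
    proof (rule SUP_approx_ennreal[OF _ _ eq])
      show "emeasure N A \<noteq> \<infinity>" using N[OF A] M.emeasure_finite by simp
    qed auto
    then obtain C where C: "C \<subseteq> A" "compact C" "emeasure N A < emeasure N C + ennreal (1 / Suc n)" by blast
    then have "C \<in> sets borel" by (simp add: borel_compact)
    then show ?thesis using C N[OF A] N[of C] by (auto intro!: exI[of _ C])
  qed
  then obtain K where K: "\<And>A n. A \<in> sets borel \<Longrightarrow> compact (K A n) \<and> K A n \<subseteq> A \<and>
      emeasure M (UNIV \<times> A) \<le> emeasure M (UNIV \<times> K A n) + ennreal (1 / Suc n)" by metis
  have Kb [measurable]: "K A n \<in> sets borel" if "A \<in> sets borel" for A n
    using K[OF that] by (simp add: borel_compact)
  \<comment> \<open>Additivity must hold for the compact approximants as well, so they are put into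
    a second countable algebra. Regularity is asked only of members of \<open>\<A>\<close>, which is
    why one enlargement suffices.\<close>
  define V' where "V' = from_nat_into (\<A> \<union> (\<lambda>(A, n). K A n) ` (\<A> \<times> UNIV))"
  have rangeV': "range V' = \<A> \<union> (\<lambda>(A, n). K A n) ` (\<A> \<times> UNIV)"
    unfolding V'_def using \<A>(2) \<A>.empty_sets by (intro range_from_nat_into) auto
  have "V' i \<in> sets borel" for i
  proof -
    have "V' i \<in> \<A> \<union> (\<lambda>(A, n). K A n) ` (\<A> \<times> UNIV)" using rangeV' by blast
    then show ?thesis using \<A>(4) Kb by auto
  qed
  then obtain \<A>' where \<A>': "algebra UNIV \<A>'" "countable \<A>'" "range V' \<subseteq> \<A>'" "\<A>' \<subseteq> sets borel"
    using countable_algebra by metis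
  have sub: "\<A> \<subseteq> \<A>'" and KA': "\<And>A n. A \<in> \<A> \<Longrightarrow> K A n \<in> \<A>'"
    using \<A>'(3) unfolding rangeV' by auto
  have AE1: "AE x in marg M. f UNIV x = 1"
    by (rule f_unique) (auto simp: emeasure_marg[OF M] nn_integral_indicator)
  have AE2: "AE x in marg M. f (A \<union> B) x = f A x + f B x"
    if AB [measurable]: "A \<in> sets borel" "B \<in> sets borel" and disj: "A \<inter> B = {}" for A B
  proof (rule f_unique)
    fix X :: "'x set" assume X [measurable]: "X \<in> sets borel"
    have "(\<integral>\<^sup>+x\<in>X. (f A x + f B x) \<partial>marg M) = (\<integral>\<^sup>+x\<in>X. f A x \<partial>marg M) + (\<integral>\<^sup>+x\<in>X. f B x \<partial>marg M)"
      by (subst nn_integral_add[symmetric]) (auto simp: distrib_right)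
    also have "\<dots> = emeasure M (X \<times> A \<union> X \<times> B)"
      using disj X AB by (subst plus_emeasure[symmetric]) (auto simp: fM)
    finally show "(\<integral>\<^sup>+x\<in>X. (f A x + f B x) \<partial>marg M) = emeasure M (X \<times> (A \<union> B))"
      by (simp add: Sigma_Un_distrib2)
  qed auto
  \<comment> \<open>Almost everywhere \<open>f A\<close> dominates the supremum, by additivity.
    Inner regularity gives both sides the same finite integral, so their nonnegative difference
    integrates to 0.\<close>
  have AE3: "AE x in marg M. f A x = (SUP n. f (K A n) x)" if A [measurable]: "A \<in> sets borel" for A
  proof -
    note [measurable] = Kb[OF A]
    have le: "AE x in marg M. f (K A n) x \<le> f A x" for n
    proof -
      have "AE x in marg M. f (K A n \<union> (A - K A n)) x = f (K A n) x + f (A - K A n) x"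
        by (rule AE2) auto
      then show ?thesis
      proof eventually_elim
        case (elim x)
        then show ?case using K[OF A, of n] by (simp add: Un_absorb1)
      qed
    qed
    have "AE x in marg M. \<forall>n. f (K A n) x \<le> f A x" using le by (simp add: AE_all_countable)
    then have le': "AE x in marg M. (SUP n. f (K A n) x) \<le> f A x"
      by (auto elim!: eventually_mono intro: SUP_least)
    have int: "(\<integral>\<^sup>+x. f B x \<partial>marg M) = emeasure M (UNIV \<times> B)" if "B \<in> sets borel" for B
      using fM[OF that, of UNIV] by simp
    have fin: "(\<integral>\<^sup>+x. (SUP n. f (K A n) x) \<partial>marg M) \<le> emeasure M (UNIV \<times> A)"
      using nn_integral_mono_AE[OF le'] by (simp add: int)
    have fin_A: "emeasure M (UNIV \<times> A) < \<top>" by (simp add: less_top[symmetric])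
    have "(\<integral>\<^sup>+x. f A x - (SUP n. f (K A n) x) \<partial>marg M)
        = emeasure M (UNIV \<times> A) - (\<integral>\<^sup>+x. (SUP n. f (K A n) x) \<partial>marg M)"
      using le' fin M.emeasure_finite by (subst nn_integral_diff) (auto simp: int top_unique)
    moreover have "emeasure M (UNIV \<times> A) \<le> (\<integral>\<^sup>+x. (SUP n. f (K A n) x) \<partial>marg M)"
    proof (rule ennreal_le_epsilon)
      fix e :: real assume "0 < e"
      then obtain n where n: "1 / Suc n < e" using nat_approx_posE by blast
      have "emeasure M (UNIV \<times> A) \<le> emeasure M (UNIV \<times> K A n) + ennreal (1 / Suc n)" using K[OF A] by blast
      also have "emeasure M (UNIV \<times> K A n) = (\<integral>\<^sup>+x. f (K A n) x \<partial>marg M)" by (simp add: int)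
      also have "\<dots> \<le> (\<integral>\<^sup>+x. (SUP n. f (K A n) x) \<partial>marg M)" by (intro nn_integral_mono SUP_upper) auto
      also have "ennreal (1 / Suc n) \<le> ennreal e" using n by (intro ennreal_leI) auto
      finally show "emeasure M (UNIV \<times> A) \<le> (\<integral>\<^sup>+x. (SUP n. f (K A n) x) \<partial>marg M) + ennreal e"
        by (simp add: add_left_mono)
    qed
    ultimately have "(\<integral>\<^sup>+x. f A x - (SUP n. f (K A n) x) \<partial>marg M) = 0"
      using fin fin_A by (simp add: diff_eq_0_ennreal)
    then have "AE x in marg M. f A x - (SUP n. f (K A n) x) = 0"
      by (subst (asm) nn_integral_0_iff_AE) auto
    with le' show ?thesis
    proof eventually_elim
      case (elim x)
      then show ?case by (metis add.right_neutral antisym diff_add_self_ennreal ennreal_minus_eq_0 order_refl)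
    qed
  qed
  define good where "good x \<longleftrightarrow> f UNIV x = 1 \<and>
    (\<forall>A\<in>\<A>'. \<forall>B\<in>\<A>'. A \<inter> B = {} \<longrightarrow> f (A \<union> B) x = f A x + f B x) \<and>
    (\<forall>A\<in>\<A>. f A x = (SUP n. f (K A n) x))" for x
  have "AE x in marg M. good x"
    unfolding good_def using \<A>'(4) \<A>(4)
    by (intro AE_conjI AE1 AE_ball_countable'[OF _ \<A>'(2)] AE_ball_countable'[OF _ \<A>(2)] AE_impI AE2 AE3) auto
  then obtain Z where Z: "{x. \<not> good x} \<subseteq> Z" "Z \<in> sets borel" "emeasure (marg M) Z = 0"
    by (elim AE_E) auto
  have "\<exists>\<mu>. sets \<mu> = sets borel \<and> (\<forall>A\<in>\<A>. emeasure \<mu> A = f A x)" if "x \<notin> Z" for x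
  proof -
    have "good x" using Z(1) that by auto
    then show ?thesis unfolding sigma good_def
      using K \<A>(4) KA' by (intro compact_inner_regular_extension[OF \<A>'(1) \<A>(1) sub, where K = K]) auto
  qed
  then obtain \<mu> where \<mu>: "\<And>x. x \<notin> Z \<Longrightarrow> sets (\<mu> x) = sets borel" "\<And>x A. x \<notin> Z \<Longrightarrow> A \<in> \<A> \<Longrightarrow> emeasure (\<mu> x) A = f A x"
    by metis
  \<comment> \<open>\<open>is_rcd\<close> demands a probability measure at every point. A fixed
    point mass serves on the null set \<open>Z\<close>, keeping \<open>\<kappa>\<close> measurable
    and leaving all integrals unchanged.\<close>
  define \<kappa> where "\<kappa> x = (if x \<in> Z then return borel undefined else \<mu> x)" for x
  have \<kappa>_sets: "sets (\<kappa> x) = sets borel" for x using \<mu>(1) by (simp add: \<kappa>_def)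
  have \<kappa>_prob: "prob_space (\<kappa> x)" for x
  proof (cases "x \<in> Z")
    case False
    then have "f UNIV x = 1" using Z(1) by (auto simp: good_def)
    then have "emeasure (\<mu> x) UNIV = 1" using \<mu>(2)[OF False] by simp
    then show ?thesis
      using False sets_eq_imp_space_eq[OF \<mu>(1)[OF False]] by (intro prob_spaceI) (simp add: \<kappa>_def)
  qed (simp add: \<kappa>_def prob_space_return)
  have \<kappa>_meas: "\<kappa> \<in> borel \<rightarrow>\<^sub>M prob_algebra borel"
  proof (rule measurable_prob_algebra_generated[OF sigma])
    show "Int_stable \<A>" by (auto simp: Int_stable_def)
    fix A assume A: "A \<in> \<A>"
    then have [measurable]: "A \<in> sets borel" using \<A>(4) by auto
    have "(\<lambda>x. emeasure (\<kappa> x) A) = (\<lambda>x. if x \<in> Z then indicator A undefined else f A x)"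
      using \<mu>(2)[OF _ A] by (auto simp: \<kappa>_def)
    also have "\<dots> \<in> borel_measurable borel" using Z(2) by measurable
    finally show "(\<lambda>x. emeasure (\<kappa> x) A) \<in> borel_measurable borel" .
  qed (use \<kappa>_sets \<kappa>_prob in auto)
  have AEZ: "AE x in marg M. x \<notin> Z" using Z by (intro AE_not_in) (auto simp: null_sets_def)
  have rect: "emeasure M (X \<times> Y) = (\<integral>\<^sup>+x. emeasure (\<kappa> x) Y * indicator X x \<partial>marg M)"
    if X [measurable]: "X \<in> sets borel" and Y: "Y \<in> sets borel" for X Y
  proof -
    \<comment> \<open>For fixed \<open>X\<close> both sides are finite measures in \<open>Y\<close>:
      the left one is \<open>R\<close>, the right one \<open>D \<bind> \<kappa>\<close>. It suffices
      to compare them on \<open>\<A>\<close>, where \<open>\<kappa>\<close> is given by the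
      densities off \<open>Z\<close>.\<close>
    define D where "D = density (marg M) (indicator X)"
    have [measurable_cong, simp]: "sets D = sets borel" and [simp]: "space D = UNIV" by (simp_all add: D_def)
    have \<kappa>_D: "\<kappa> \<in> D \<rightarrow>\<^sub>M subprob_algebra borel" using measurable_prob_algebraD[OF \<kappa>_meas] by simp
    have E1: "emeasure (D \<bind> \<kappa>) Y = (\<integral>\<^sup>+x. emeasure (\<kappa> x) Y * indicator X x \<partial>marg M)" if Y: "Y \<in> sets borel" for Y
    proof -
      have "emeasure (D \<bind> \<kappa>) Y = (\<integral>\<^sup>+x. emeasure (\<kappa> x) Y \<partial>D)"
        using \<kappa>_D Y by (intro emeasure_bind) auto
      also have "\<dots> = (\<integral>\<^sup>+x. emeasure (\<kappa> x) Y * indicator X x \<partial>marg M)"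
        unfolding D_def using measurable_measure_prob_algebra_kernel(2)[OF \<kappa>_meas Y]
        by (subst nn_integral_density) (auto simp: mult.commute)
      finally show ?thesis .
    qed
    define R where "R = distr (density M (indicator (X \<times> UNIV))) borel (snd :: 'x \<times> 'y \<Rightarrow> 'y)"
    have E2: "emeasure R Y = emeasure M (X \<times> Y)" if Y [measurable]: "Y \<in> sets borel" for Y
    proof -
      have "emeasure R Y = emeasure (density M (indicator (X \<times> UNIV))) (UNIV \<times> Y)"
        unfolding R_def by (subst emeasure_distr) (auto intro!: arg_cong2[where f = emeasure])
      also have "\<dots> = emeasure M (X \<times> Y)"
      proof -
        have "(\<lambda>p. indicator (X \<times> UNIV) p * indicator (UNIV \<times> Y) p :: ennreal) = indicator (X \<times> Y)"
          by (auto simp: fun_eq_iff split: split_indicator)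
        then show ?thesis by (subst emeasure_density) simp_all
      qed
      finally show ?thesis .
    qed
    have "R = D \<bind> \<kappa>"
    proof (rule measure_eqI_generator_eq[where E = \<A> and \<Omega> = UNIV and A = "\<lambda>_. UNIV"])
      show "Int_stable \<A>" by (auto simp: Int_stable_def)
      show "sets R = sigma_sets UNIV \<A>" by (simp add: R_def sigma)
      show "sets (D \<bind> \<kappa>) = sigma_sets UNIV \<A>" using sets_bind[of D \<kappa> borel] \<kappa>_sets by (simp add: sigma)
      show "emeasure R UNIV \<noteq> \<infinity>" by (simp add: E2)
      fix A assume A: "A \<in> \<A>"
      then have Ab: "A \<in> sets borel" using \<A>(4) by auto
      have "emeasure (D \<bind> \<kappa>) A = (\<integral>\<^sup>+x. emeasure (\<kappa> x) A * indicator X x \<partial>marg M)" by (rule E1[OF Ab])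
      also have "\<dots> = (\<integral>\<^sup>+x\<in>X. f A x \<partial>marg M)"
        using AEZ by (intro nn_integral_cong_AE) (auto elim!: eventually_mono simp: \<kappa>_def \<mu>(2)[OF _ A])
      finally show "emeasure R A = emeasure (D \<bind> \<kappa>) A" using Ab X by (simp add: fM E2)
    qed auto
    then show ?thesis using E1[OF Y] E2[OF Y] by simp
  qed
  with \<kappa>_meas have "is_rcd M \<kappa>" unfolding is_rcd_iff_emeasure[OF M] by blast
  then show ?thesis by (rule exI[of "is_rcd M"])
qed

section \<open>Uniqueness of conditional distributions and integration against them\<close>

lemma is_rcd_cond:
  fixes M :: "('x::second_countable_topology \<times> 'y::polish_space) measure"
  assumes "M \<in> probs euclidean"
  shows "is_rcd M (cond M)"
  unfolding cond_def using regular_conditional_distribution_exists[OF assms] by (rule someI_ex)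

lemma is_rcd_prob_algebra:
  fixes M :: "('x::second_countable_topology \<times> 'y::{metric_space, second_countable_topology}) measure"
  shows "is_rcd M \<kappa> \<Longrightarrow> \<kappa> \<in> borel \<rightarrow>\<^sub>M prob_algebra borel"
  by (simp add: is_rcd_def measurable_weakT_iff_prob_algebra)

text \<open>Both sides are densities with respect to the marginal of the same set function of
  \<open>X\<close>. The exceptional null set may depend on \<open>Y\<close>.\<close>

lemma is_rcd_unique:
  fixes M :: "('x::second_countable_topology \<times> 'y::{metric_space, second_countable_topology}) measure"
  assumes M: "M \<in> probs euclidean" and \<kappa>: "is_rcd M \<kappa>" "is_rcd M \<kappa>'" and Y: "Y \<in> sets borel"
  shows "AE x in marg M. measure (\<kappa> x) Y = measure (\<kappa>' x) Y"
proof (rule density_unique_real)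
  interpret m: prob_space "marg M" using probsD[OF marg_probs[OF M]] by simp
  have "integrable (marg M) (\<lambda>x. measure (\<kappa> x) Y)" if "is_rcd M \<kappa>" for \<kappa>
  proof -
    note K = is_rcd_prob_algebra[OF that]
    have "measure (\<kappa> x) Y \<le> 1" for x
      using prob_space.prob_le_1[OF probsD(1)[OF prob_algebra_probs[OF K]]] by simp
    then show ?thesis
      using measurable_measure_prob_algebra_kernel(1)[OF K Y]
      by (intro m.integrable_const_bound[of _ 1]) auto
  qed
  then show "integrable (marg M) (\<lambda>x. measure (\<kappa> x) Y)" "integrable (marg M) (\<lambda>x. measure (\<kappa>' x) Y)"
    using \<kappa> by auto
  fix X assume "X \<in> sets (marg M)"
  then show "(LINT x:X|marg M. measure (\<kappa> x) Y) = (LINT x:X|marg M. measure (\<kappa>' x) Y)"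
    using \<kappa> Y unfolding is_rcd_def by simp
qed

lemma measure_eqI_rectangles:
  fixes M N :: "('x::second_countable_topology \<times> 'y::second_countable_topology) measure"
  assumes sets: "sets M = sets borel" "sets N = sets borel" and fin: "emeasure M UNIV \<noteq> \<infinity>"
    and eq: "\<And>X Y. X \<in> sets borel \<Longrightarrow> Y \<in> sets borel \<Longrightarrow> emeasure M (X \<times> Y) = emeasure N (X \<times> Y)"
  shows "M = N"
proof (rule measure_eqI_generator_eq[where E = "{X \<times> Y | X Y. X \<in> sets borel \<and> Y \<in> sets borel}"
      and \<Omega> = UNIV and A = "\<lambda>_. UNIV"])
  have *: "sets (borel :: ('x \<times> 'y) measure) = sigma_sets UNIV {X \<times> Y | X Y. X \<in> sets borel \<and> Y \<in> sets borel}"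
    unfolding borel_prod[symmetric] sets_pair_measure by simp
  show "sets M = sigma_sets UNIV {X \<times> Y | X Y. X \<in> sets borel \<and> Y \<in> sets borel}"
    "sets N = sigma_sets UNIV {X \<times> Y | X Y. X \<in> sets borel \<and> Y \<in> sets borel}"
    using sets * by auto
  have "UNIV \<times> UNIV \<in> {X \<times> Y | X Y. X \<in> sets (borel :: 'x measure) \<and> Y \<in> sets (borel :: 'y measure)}"
    by (intro CollectI exI[of _ UNIV] conjI refl) simp_all
  then show "range (\<lambda>_. UNIV) \<subseteq> {X \<times> Y | X Y. X \<in> sets (borel :: 'x measure) \<and> Y \<in> sets (borel :: 'y measure)}"
    by simp
  show "Int_stable {X \<times> Y | X Y. X \<in> sets (borel :: 'x measure) \<and> Y \<in> sets (borel :: 'y measure)}"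
    by (rule Int_stable_pair_measure_generator)
  show "emeasure M Z = emeasure N Z"
    if "Z \<in> {X \<times> Y | X Y. X \<in> sets (borel :: 'x measure) \<and> Y \<in> sets (borel :: 'y measure)}" for Z
    using that eq by auto
qed (use fin in simp_all)

text \<open>\<open>M\<close> is the mixture over its marginal of the fibre measures
  \<open>L x\<close>, the images of \<open>\<kappa> x\<close> under \<open>Pair x\<close>, since the
  two agree on rectangles. On a fibre \<open>fst p\<close> is constant, so \<open>G\<close> leaves
  the inner integral.\<close>

lemma disintegration_integral:
  fixes M :: "('x::second_countable_topology \<times> 'y::{metric_space, second_countable_topology}) measure"
    and G :: "'x \<Rightarrow> real" and u :: "'y \<Rightarrow> real"
  assumes M: "M \<in> probs euclidean" and rcd: "is_rcd M \<kappa>"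
    and G [measurable]: "G \<in> borel_measurable borel" and u [measurable]: "u \<in> borel_measurable borel"
    and bound: "\<And>x. \<bar>G x\<bar> \<le> C" "\<And>y. \<bar>u y\<bar> \<le> D"
  shows "(\<integral>p. u (snd p) * G (fst p) \<partial>M) = (\<integral>x. (\<integral>y. u y \<partial>\<kappa> x) * G x \<partial>marg M)"
proof -
  interpret m: prob_space "marg M" using probsD[OF marg_probs[OF M]] by simp
  note [measurable_cong] = probsD(2)[OF M]
  note K = is_rcd_prob_algebra[OF rcd]
  have \<kappa>: "prob_space (\<kappa> x)" "sets (\<kappa> x) = sets borel" "space (\<kappa> x) = UNIV" for x
    using probsD[OF prob_algebra_probs[OF K]] by auto
  define L where "L x = distr (\<kappa> x) borel (Pair x)" for x
  have meas_Pair [measurable]: "Pair x \<in> \<kappa> x \<rightarrow>\<^sub>M borel" for x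
    using \<kappa>(2)[of x] by (simp flip: borel_prod cong: measurable_cong_sets)
  have L: "L \<in> marg M \<rightarrow>\<^sub>M subprob_algebra borel"
  proof -
    have "case_prod Pair \<in> borel \<Otimes>\<^sub>M borel \<rightarrow>\<^sub>M (borel :: ('x \<times> 'y) measure)"
      unfolding borel_prod by simp
    from measurable_distr2[OF this measurable_prob_algebraD[OF K]] show ?thesis
      unfolding L_def[abs_def] by (simp cong: measurable_cong_sets)
  qed
  have eq: "M = marg M \<bind> L"
  proof (rule measure_eqI_rectangles)
    show "sets M = sets borel" "emeasure M UNIV \<noteq> \<infinity>" using probsD[OF M] by auto
    show "sets (marg M \<bind> L) = sets borel"
      by (rule sets_bind) (auto simp: L_def)
    fix X :: "'x set" and Y :: "'y set" assume XY: "X \<in> sets borel" "Y \<in> sets borel"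
    have "emeasure (marg M \<bind> L) (X \<times> Y) = (\<integral>\<^sup>+x. emeasure (L x) (X \<times> Y) \<partial>marg M)"
      using L Times_borel[OF XY] by (intro emeasure_bind) auto
    also have "\<dots> = (\<integral>\<^sup>+x. emeasure (\<kappa> x) Y * indicator X x \<partial>marg M)"
    proof (intro nn_integral_cong)
      fix x
      have "emeasure (L x) (X \<times> Y) = emeasure (\<kappa> x) (Pair x -` (X \<times> Y))"
        unfolding L_def using Times_borel[OF XY] by (subst emeasure_distr) (auto simp: \<kappa>)
      also have "Pair x -` (X \<times> Y) = (if x \<in> X then Y else {})" by auto
      finally show "emeasure (L x) (X \<times> Y) = emeasure (\<kappa> x) Y * indicator X x" by simp
    qed
    also have "\<dots> = emeasure M (X \<times> Y)"
      using rcd XY unfolding is_rcd_iff_emeasure[OF M] by auto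
    finally show "emeasure M (X \<times> Y) = emeasure (marg M \<bind> L) (X \<times> Y)" ..
  qed
  have "(\<integral>p. u (snd p) * G (fst p) \<partial>M) = (\<integral>p. u (snd p) * G (fst p) \<partial>(marg M \<bind> L))"
    using eq by simp
  also have "\<dots> = (\<integral>x. (\<integral>p. u (snd p) * G (fst p) \<partial>L x) \<partial>marg M)"
  proof (rule integral_bind[where K = borel and B = "D * C" and B' = 1])
    show "\<bar>u (snd p) * G (fst p)\<bar> \<le> D * C" for p
      unfolding abs_mult using bound by (intro mult_mono) (auto intro: order_trans[OF abs_ge_zero])
    show "AE x in marg M. emeasure (L x) (space (L x)) \<le> ennreal 1"
    proof (rule AE_I2)
      fix x
      have "prob_space (L x)" unfolding L_def using \<kappa>(1) meas_Pair by (rule prob_space.prob_space_distr)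
      then show "emeasure (L x) (space (L x)) \<le> ennreal 1" by (simp add: prob_space.emeasure_space_1)
    qed
  qed (use L m.finite_measure_axioms in auto)
  also have "\<dots> = (\<integral>x. (\<integral>y. u y \<partial>\<kappa> x) * G x \<partial>marg M)"
  proof (rule Bochner_Integration.integral_cong[OF refl])
    fix x
    show "(\<integral>p. u (snd p) * G (fst p) \<partial>L x) = (\<integral>y. u y \<partial>\<kappa> x) * G x"
      unfolding L_def by (subst integral_distr) auto
  qed
  finally show ?thesis .
qed

section \<open>Continuity of the conditional product\<close>

text \<open>Induction over integrable functions reduces this to indicators. Outer regularity
  encloses \<open>A\<close> in an open \<open>W\<close> of nearly the same mass, and tents over
  \<open>W\<close> converge to its indicator.\<close>

lemma continuous_dense_L1:
  fixes m :: "'x::{second_countable_topology, complete_space} measure" and f :: "'x \<Rightarrow> real"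
  assumes m: "m \<in> probs euclidean" and f: "integrable m f" and "0 < e"
  shows "\<exists>h. continuous_on UNIV h \<and> bounded (range h) \<and> (\<integral>x. \<bar>f x - h x\<bar> \<partial>m) < e"
proof -
  interpret m: prob_space m using probsD[OF m] by simp
  note [measurable_cong, simp] = probsD(2)[OF m]
  note [simp] = probsD(3)[OF m]
  have cont_meas: "h \<in> borel_measurable borel" if "continuous_on UNIV h" for h :: "'x \<Rightarrow> real"
    using that by (rule borel_measurable_continuous_onI)
  have cont_int: "integrable m h" if h: "continuous_on UNIV h" "bounded (range h)" for h :: "'x \<Rightarrow> real"
  proof -
    obtain B where "\<And>x. norm (h x) \<le> B" using h(2) by (auto simp: bounded_iff)
    then show ?thesis using cont_meas[OF h(1)] by (intro m.integrable_const_bound[of _ B]) auto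
  qed
  have "\<forall>e>0. \<exists>h. continuous_on UNIV h \<and> bounded (range h) \<and> (\<integral>x. \<bar>f x - h x\<bar> \<partial>m) < e"
    using f
  proof (induction rule: integrable_induct)
    case (base A c)
    show ?case
    proof (intro allI impI)
      fix e :: real assume "0 < e"
      \<comment> \<open>Chosen so that \<open>\<bar>c\<bar> * d \<le> e / 2\<close>; the summand 1
        keeps the denominator positive for \<open>c = 0\<close>.\<close>
      define d where "d = e / (2 * (\<bar>c\<bar> + 1))"
      have d: "0 < d" "\<bar>c\<bar> * d \<le> e / 2" using \<open>0 < e\<close> by (auto simp: d_def field_simps)
      have A [measurable]: "A \<in> sets borel" using base by simp
      have "emeasure m A = (INF W\<in>{W. A \<subseteq> W \<and> open W}. emeasure m W)"
        using A by (intro outer_regular) auto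
      moreover have "emeasure m A < ennreal (measure m A + d)"
        using d(1) by (simp add: m.emeasure_eq_measure ennreal_less_iff)
      ultimately obtain W where W: "A \<subseteq> W" "open W" "emeasure m W < ennreal (measure m A + d)"
        by (auto simp: INF_less_iff)
      have [measurable]: "W \<in> sets borel" using W(2) by simp
      have mW: "measure m W < measure m A + d"
        using W(3) d(1) by (simp add: m.emeasure_eq_measure ennreal_less_iff del: ennreal_plus)
      note [measurable] = cont_meas[OF continuous_on_tent]
      have "(\<lambda>j. tent W j x) \<longlonglongrightarrow> indicator W x" for x
      proof (cases "x \<in> W")
        case True
        then have "\<forall>\<^sub>F j in sequentially. tent W j x = indicator W x"
          using tent_eventually_1[OF W(2) True] by (auto simp: eventually_sequentially)
        then show ?thesis by (rule tendsto_eventually)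
      qed (simp add: tent_eq_0)
      then have "(\<lambda>j. \<bar>tent W j x - indicator A x\<bar>) \<longlonglongrightarrow> \<bar>indicator W x - indicator A x\<bar>" for x
        by (intro tendsto_intros)
      moreover have le1: "\<bar>tent W j x - indicator A x\<bar> \<le> 1" for j x
        using tent_range[of W j x] by (auto simp: indicator_def)
      ultimately have "(\<lambda>j. \<integral>x. \<bar>tent W j x - indicator A x\<bar> \<partial>m) \<longlonglongrightarrow> (\<integral>x. \<bar>indicator W x - indicator A x\<bar> \<partial>m)"
        by (intro integral_dominated_convergence[where w = "\<lambda>_. 1"])
           (auto simp: le1)
      also have "(\<integral>x. \<bar>indicator W x - indicator A x\<bar> \<partial>m) = (\<integral>x. indicator W x - (indicator A x :: real) \<partial>m)"
        using W(1) by (intro Bochner_Integration.integral_cong) (auto simp: indicator_def)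
      also have "\<dots> = measure m W - measure m A"
        by (subst Bochner_Integration.integral_diff) (auto simp: less_top[symmetric])
      finally have "\<forall>\<^sub>F j in sequentially. (\<integral>x. \<bar>tent W j x - indicator A x\<bar> \<partial>m) < d"
        using mW by (intro order_tendstoD) auto
      then obtain j where j: "(\<integral>x. \<bar>tent W j x - indicator A x\<bar> \<partial>m) < d"
        by (auto simp: eventually_sequentially)
      have "(\<integral>x. \<bar>indicator A x *\<^sub>R c - c * tent W j x\<bar> \<partial>m) = (\<integral>x. \<bar>c\<bar> * \<bar>tent W j x - indicator A x\<bar> \<partial>m)"
        by (intro Bochner_Integration.integral_cong) (auto simp: abs_mult[symmetric] algebra_simps abs_minus_commute)
      also have "\<dots> = \<bar>c\<bar> * (\<integral>x. \<bar>tent W j x - indicator A x\<bar> \<partial>m)" by simp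
      also have "\<dots> \<le> \<bar>c\<bar> * d" using j by (intro mult_left_mono) auto
      also have "\<dots> < e" using d(2) \<open>0 < e\<close> by simp
      finally show "\<exists>h. continuous_on UNIV h \<and> bounded (range h) \<and> (\<integral>x. \<bar>indicator A x *\<^sub>R c - h x\<bar> \<partial>m) < e"
        by (intro exI[of _ "\<lambda>x. c * tent W j x"])
           (auto intro!: continuous_intros continuous_on_tent exI[of _ "\<bar>c\<bar>"]
             simp: bounded_iff abs_mult tent_range mult_left_le)
    qed
  next
    case (add f g)
    show ?case
    proof (intro allI impI)
      fix e :: real assume "0 < e"
      then have "0 < e / 2" by simp
      from add.IH(1)[rule_format, OF this] add.IH(2)[rule_format, OF this] obtain h k
        where h: "continuous_on UNIV h" "bounded (range h)" "(\<integral>x. \<bar>f x - h x\<bar> \<partial>m) < e / 2"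
          and k: "continuous_on UNIV k" "bounded (range k)" "(\<integral>x. \<bar>g x - k x\<bar> \<partial>m) < e / 2" by blast
      have int: "integrable m (\<lambda>x. \<bar>f x - h x\<bar>)" "integrable m (\<lambda>x. \<bar>g x - k x\<bar>)"
        using add.hyps cont_int h k by auto
      have "(\<integral>x. \<bar>f x + g x - (h x + k x)\<bar> \<partial>m) \<le> (\<integral>x. \<bar>f x - h x\<bar> + \<bar>g x - k x\<bar> \<partial>m)"
        using add.hyps cont_int h k int by (intro integral_mono) auto
      also have "\<dots> < e" using h(3) k(3) int by simp
      finally show "\<exists>h. continuous_on UNIV h \<and> bounded (range h) \<and> (\<integral>x. \<bar>f x + g x - h x\<bar> \<partial>m) < e"
        using h k bounded_plus_comp[of h UNIV k]
        by (intro exI[of _ "\<lambda>x. h x + k x"]) (auto intro!: continuous_intros)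
    qed
  next
    case (lim f s)
    show ?case
    proof (intro allI impI)
      fix e :: real assume "0 < e"
      have [measurable]: "f \<in> borel_measurable m" "s i \<in> borel_measurable m" for i using lim.hyps by auto
      have "(\<lambda>i. \<integral>x. \<bar>f x - s i x\<bar> \<partial>m) \<longlonglongrightarrow> (\<integral>x. 0 \<partial>m)"
      \<comment> \<open>The induction rule supplies
        \<open>\<bar>s i x\<bar> \<le> 2 * \<bar>f x\<bar>\<close>; one more
        \<open>\<bar>f x\<bar>\<close> comes from the triangle inequality.\<close>
      proof (rule integral_dominated_convergence[where w = "\<lambda>x. 3 * \<bar>f x\<bar>"])
        show "integrable m (\<lambda>x. 3 * \<bar>f x\<bar>)" using lim.hyps by auto
        show "AE x in m. (\<lambda>i. \<bar>f x - s i x\<bar>) \<longlonglongrightarrow> 0"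
        proof (rule AE_I2)
          fix x assume "x \<in> space m"
          then have "(\<lambda>i. \<bar>f x - s i x\<bar>) \<longlonglongrightarrow> \<bar>f x - f x\<bar>"
            using lim.hyps by (intro tendsto_intros) auto
          then show "(\<lambda>i. \<bar>f x - s i x\<bar>) \<longlonglongrightarrow> 0" by simp
        qed
        show "AE x in m. norm \<bar>f x - s i x\<bar> \<le> 3 * \<bar>f x\<bar>" for i
        proof (rule AE_I2)
          fix x assume "x \<in> space m"
          then have "\<bar>s i x\<bar> \<le> 2 * \<bar>f x\<bar>" using lim.hyps(3)[of x i] by simp
          then show "norm \<bar>f x - s i x\<bar> \<le> 3 * \<bar>f x\<bar>" by simp
        qed
      qed auto
      then have "\<forall>\<^sub>F i in sequentially. (\<integral>x. \<bar>f x - s i x\<bar> \<partial>m) < e / 2"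
        using \<open>0 < e\<close> by (intro order_tendstoD) auto
      then obtain i where i: "(\<integral>x. \<bar>f x - s i x\<bar> \<partial>m) < e / 2" by (auto simp: eventually_sequentially)
      obtain h where h: "continuous_on UNIV h" "bounded (range h)" "(\<integral>x. \<bar>s i x - h x\<bar> \<partial>m) < e / 2"
        using lim.IH[rule_format, of "e / 2" i] \<open>0 < e\<close> by auto
      have int: "integrable m (\<lambda>x. \<bar>f x - s i x\<bar>)" "integrable m (\<lambda>x. \<bar>s i x - h x\<bar>)" "integrable m (\<lambda>x. \<bar>f x - h x\<bar>)"
        using lim.hyps cont_int[OF h(1,2)] by auto
      have "(\<integral>x. \<bar>f x - h x\<bar> \<partial>m) \<le> (\<integral>x. \<bar>f x - s i x\<bar> + \<bar>s i x - h x\<bar> \<partial>m)"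
        using int by (intro integral_mono) auto
      also have "\<dots> < e" using i h(3) int by simp
      finally show "\<exists>h. continuous_on UNIV h \<and> bounded (range h) \<and> (\<integral>x. \<bar>f x - h x\<bar> \<partial>m) < e"
        using h by blast
    qed
  qed
  with \<open>0 < e\<close> show ?thesis by blast
qed

section \<open>The conditional product of one consistent pair\<close>

locale conditional_product =
  fixes \<mu> :: "('a::polish_space \<times> 'b::polish_space) measure"
    and \<nu> :: "('a \<times> 'c::polish_space) measure"
    and \<Phi> :: "('a \<times> 'b \<times> 'c) measure"
  assumes \<mu>: "\<mu> \<in> probs euclidean" and \<nu>: "\<nu> \<in> probs euclidean" and \<Phi>: "\<Phi> \<in> probs euclidean"
    and consistent: "marg \<mu> = marg \<nu>"
    and rect: "\<And>A B C. A \<in> sets borel \<Longrightarrow> B \<in> sets borel \<Longrightarrow> C \<in> sets borel \<Longrightarrow>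
        measure \<Phi> (A \<times> B \<times> C) = (LINT ac:(A \<times> C)|\<nu>. measure (cond \<mu> (fst ac)) B)"
begin

sublocale \<mu>: prob_space \<mu> using probsD[OF \<mu>] by simp
sublocale \<nu>: prob_space \<nu> using probsD[OF \<nu>] by simp
sublocale \<Phi>: prob_space \<Phi> using probsD[OF \<Phi>] by simp

lemma sets_eqs [simp, measurable_cong]:
  "sets \<mu> = sets borel" "sets \<nu> = sets borel" "sets \<Phi> = sets borel"
  "space \<mu> = UNIV" "space \<nu> = UNIV" "space \<Phi> = UNIV"
  using probsD[OF \<mu>] probsD[OF \<nu>] probsD[OF \<Phi>] by auto

text \<open>\<open>cond\<close> conditions on the first factor of a binary product. Conditioning on
  \<open>(a, c)\<close> is therefore expressed after regrouping the triple.\<close>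

abbreviation "swap \<equiv> (\<lambda>(a, b, c). ((a, c), b)) :: 'a \<times> 'b \<times> 'c \<Rightarrow> ('a \<times> 'c) \<times> 'b"

lemma swap_measurable [measurable]: "swap \<in> borel \<rightarrow>\<^sub>M borel"
  by (rule borel_measurable_continuous_onI) (auto simp: case_prod_beta' intro!: continuous_intros)

lemma proj_measurable [measurable]:
  "(\<lambda>(a, b, c). (a, c)) \<in> (borel :: ('a \<times> 'b \<times> 'c) measure) \<rightarrow>\<^sub>M borel"
  "(\<lambda>(a, b, c). (a, b)) \<in> (borel :: ('a \<times> 'b \<times> 'c) measure) \<rightarrow>\<^sub>M borel"
  by (rule borel_measurable_continuous_onI, simp add: case_prod_beta', intro continuous_intros)+

lemma cond_kernel: "cond \<mu> \<in> borel \<rightarrow>\<^sub>M prob_algebra borel"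
  using is_rcd_cond[OF \<mu>] by (rule is_rcd_prob_algebra)

lemma cond_kernel_fst: "(\<lambda>ac :: 'a \<times> 'c. cond \<mu> (fst ac)) \<in> borel \<rightarrow>\<^sub>M prob_algebra borel"
  using measurable_compose[OF measurable_fst_borel cond_kernel] .

lemma emeasure_rect:
  assumes "A \<in> sets borel" "B \<in> sets borel" "C \<in> sets borel"
  shows "emeasure \<Phi> (A \<times> B \<times> C) = (\<integral>\<^sup>+ac. emeasure (cond \<mu> (fst ac)) B * indicator (A \<times> C) ac \<partial>\<nu>)"
  using set_integral_kernel[OF cond_kernel_fst \<nu> Times_borel[OF assms(1,3)] assms(2)] rect[OF assms]
  by (simp add: \<Phi>.emeasure_eq_measure)

lemma emeasure_cond_UNIV: "emeasure (cond \<mu> a) UNIV = 1"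
  using probsD(5)[OF prob_algebra_probs[OF cond_kernel]] by simp

lemma distr_ac: "distr \<Phi> borel (\<lambda>(a, b, c). (a, c)) = \<nu>"
proof (rule measure_eqI_rectangles)
  fix A :: "'a set" and C :: "'c set" assume AC: "A \<in> sets borel" "C \<in> sets borel"
  have "emeasure (distr \<Phi> borel (\<lambda>(a, b, c). (a, c))) (A \<times> C) = emeasure \<Phi> (A \<times> UNIV \<times> C)"
    using Times_borel[OF AC] by (subst emeasure_distr) (auto intro!: arg_cong2[where f = emeasure])
  also have "\<dots> = emeasure \<nu> (A \<times> C)"
    using AC Times_borel[OF AC] by (subst emeasure_rect) (auto simp: emeasure_cond_UNIV)
  finally show "emeasure (distr \<Phi> borel (\<lambda>(a, b, c). (a, c))) (A \<times> C) = emeasure \<nu> (A \<times> C)" .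
next
  have "prob_space (distr \<Phi> borel (\<lambda>(a, b, c). (a, c)))" by (rule \<Phi>.prob_space_distr) simp
  from prob_space.emeasure_space_1[OF this]
  show "emeasure (distr \<Phi> borel (\<lambda>(a, b, c). (a, c))) UNIV \<noteq> \<infinity>" by simp
qed simp_all

lemma nn_integral_fst_marg:
  assumes [measurable]: "g \<in> borel_measurable borel"
  shows "(\<integral>\<^sup>+ac. g (fst ac) \<partial>\<nu>) = (\<integral>\<^sup>+a. g a \<partial>marg \<mu>)"
  unfolding consistent unfolding marg_def by (subst nn_integral_distr) auto

text \<open>The choice \<open>C = UNIV\<close> leaves an integral over \<open>\<nu>\<close> of a
  function of \<open>a\<close> alone; \<open>consistent\<close> moves it to the marginal of
  \<open>\<mu>\<close>, where \<open>cond \<mu>\<close> reproduces \<open>\<mu>\<close>. Being an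
  equality of measures, it makes the conditional distribution of \<open>\<Phi>\<close> given
  \<open>a\<close> literally \<open>cond \<mu>\<close>, not just another version.\<close>

lemma distr_ab: "distr \<Phi> borel (\<lambda>(a, b, c). (a, b)) = \<mu>"
proof (rule measure_eqI_rectangles)
  fix A :: "'a set" and B :: "'b set" assume AB [measurable]: "A \<in> sets borel" "B \<in> sets borel"
  note [measurable] = measurable_measure_prob_algebra_kernel(2)[OF cond_kernel AB(2)]
  have "emeasure (distr \<Phi> borel (\<lambda>(a, b, c). (a, b))) (A \<times> B) = emeasure \<Phi> (A \<times> B \<times> UNIV)"
    using Times_borel[OF AB] by (subst emeasure_distr) (auto intro!: arg_cong2[where f = emeasure])
  also have "\<dots> = (\<integral>\<^sup>+ac. emeasure (cond \<mu> (fst ac)) B * indicator A (fst ac) \<partial>\<nu>)"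
    using AB by (subst emeasure_rect) (auto intro!: nn_integral_cong simp: indicator_def)
  also have "\<dots> = (\<integral>\<^sup>+a. emeasure (cond \<mu> a) B * indicator A a \<partial>marg \<mu>)"
    by (rule nn_integral_fst_marg) measurable
  also have "\<dots> = emeasure \<mu> (A \<times> B)"
    using is_rcd_cond[OF \<mu>] AB unfolding is_rcd_iff_emeasure[OF \<mu>] by simp
  finally show "emeasure (distr \<Phi> borel (\<lambda>(a, b, c). (a, b))) (A \<times> B) = emeasure \<mu> (A \<times> B)" .
next
  have "prob_space (distr \<Phi> borel (\<lambda>(a, b, c). (a, b)))" by (rule \<Phi>.prob_space_distr) simp
  from prob_space.emeasure_space_1[OF this]
  show "emeasure (distr \<Phi> borel (\<lambda>(a, b, c). (a, b))) UNIV \<noteq> \<infinity>" by simp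
qed simp_all

lemma swap_probs: "distr \<Phi> borel swap \<in> probs euclidean"
  unfolding in_probs_euclidean by (simp add: \<Phi>.prob_space_distr)

lemma marg_swap: "marg (distr \<Phi> borel swap) = \<nu>"
proof -
  have "marg (distr \<Phi> borel swap) = distr \<Phi> borel (fst \<circ> swap)"
    unfolding marg_def by (rule distr_distr) simp_all
  also have "fst \<circ> swap = (\<lambda>(a, b, c). (a, c))" by (auto simp: fun_eq_iff)
  finally show ?thesis by (simp add: distr_ac)
qed

text \<open>The assumption \<open>rect\<close> speaks of boxes
  \<open>A \<times> B \<times> C\<close>, whereas a disintegration given \<open>(a, c)\<close>
  concerns every Borel \<open>X\<close> in the product. For fixed \<open>Y\<close> both sides are
  finite measures in \<open>X\<close>, here \<open>N1\<close> and \<open>N2\<close>, and they agree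
  on rectangles.\<close>

lemma is_rcd_swap: "is_rcd (distr \<Phi> borel swap) (\<lambda>ac. cond \<mu> (fst ac))"
  unfolding is_rcd_iff_emeasure[OF swap_probs] marg_swap
proof (intro conjI ballI cond_kernel_fst)
  fix X :: "('a \<times> 'c) set" and Y :: "'b set"
  assume X [measurable]: "X \<in> sets borel" and Y [measurable]: "Y \<in> sets borel"
  note [measurable] = measurable_measure_prob_algebra_kernel(2)[OF cond_kernel_fst Y]
  define S where "S = swap -` (UNIV \<times> Y)"
  have S [measurable]: "S \<in> sets borel"
    using measurable_sets[OF swap_measurable, of "UNIV \<times> Y"] by (simp add: S_def)
  define N1 where "N1 = distr (density \<Phi> (indicator S)) borel (\<lambda>(a, b, c). (a, c))"
  define N2 where "N2 = density \<nu> (\<lambda>ac. emeasure (cond \<mu> (fst ac)) Y)"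
  have N1: "emeasure N1 X = emeasure (distr \<Phi> borel swap) (X \<times> Y)" if X [measurable]: "X \<in> sets borel" for X
  proof -
    have X': "(\<lambda>(a, b, c). (a, c)) -` X \<in> sets (borel :: ('a \<times> 'b \<times> 'c) measure)"
      using measurable_sets[OF proj_measurable(1) X] by simp
    have "emeasure N1 X = emeasure (density \<Phi> (indicator S)) ((\<lambda>(a, b, c). (a, c)) -` X)"
      unfolding N1_def by (subst emeasure_distr) auto
    also have "\<dots> = emeasure \<Phi> (swap -` (X \<times> Y))"
    proof -
      have eq: "(\<lambda>p. indicator S p * indicator ((\<lambda>(a, b, c). (a, c)) -` X) p :: ennreal) = indicator (swap -` (X \<times> Y))"
        by (auto simp: fun_eq_iff S_def split: split_indicator)
      have "swap -` (X \<times> Y) \<in> sets borel"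
        using measurable_sets[OF swap_measurable, of "X \<times> Y"] by simp
      then show ?thesis using X' by (subst emeasure_density) (simp_all add: eq)
    qed
    also have "\<dots> = emeasure (distr \<Phi> borel swap) (X \<times> Y)"
      by (subst emeasure_distr) auto
    finally show ?thesis .
  qed
  have N2: "emeasure N2 X = (\<integral>\<^sup>+ac. emeasure (cond \<mu> (fst ac)) Y * indicator X ac \<partial>\<nu>)" if "X \<in> sets borel" for X
    unfolding N2_def using that by (subst emeasure_density) auto
  have "N1 = N2"
  proof (rule measure_eqI_rectangles)
    fix A :: "'a set" and C :: "'c set" assume AC: "A \<in> sets borel" "C \<in> sets borel"
    have "emeasure N1 (A \<times> C) = emeasure \<Phi> (A \<times> Y \<times> C)"
      unfolding N1[OF Times_borel[OF AC]]
      using Times_borel[OF Times_borel[OF AC] Y]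
      by (subst emeasure_distr) (auto intro!: arg_cong2[where f = emeasure])
    also have "\<dots> = emeasure N2 (A \<times> C)"
      using emeasure_rect[OF AC(1) Y AC(2)] N2[OF Times_borel[OF AC]] by simp
    finally show "emeasure N1 (A \<times> C) = emeasure N2 (A \<times> C)" .
  next
    have "emeasure N1 UNIV \<le> 1"
      using N1[of UNIV] prob_space.emeasure_le_1[OF probsD(1)[OF swap_probs], of "UNIV \<times> Y"] by simp
    then show "emeasure N1 UNIV \<noteq> \<infinity>" by (auto simp: top_unique)
  qed (simp_all add: N1_def N2_def)
  then show "emeasure (distr \<Phi> borel swap) (X \<times> Y) = (\<integral>\<^sup>+ac. emeasure (cond \<mu> (fst ac)) Y * indicator X ac \<partial>\<nu>)"
    using N1[OF X] N2[OF X] by simp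
qed

lemma conditional_independence:
  assumes B: "B \<in> sets borel"
  shows "AE abc in \<Phi>. measure (cond (distr \<Phi> borel swap) (fst abc, snd (snd abc))) B = measure (cond \<mu> (fst abc)) B"
proof -
  have "AE ac in \<nu>. measure (cond (distr \<Phi> borel swap) ac) B = measure (cond \<mu> (fst ac)) B"
    using is_rcd_unique[OF swap_probs is_rcd_cond[OF swap_probs] is_rcd_swap B] unfolding marg_swap .
  \<comment> \<open>The exceptional set lives on pairs \<open>(a, c)\<close>; writing
    \<open>\<nu>\<close> as an image of \<open>\<Phi>\<close> pulls it back to triples.\<close>
  then have "AE ac in distr \<Phi> borel (\<lambda>(a, b, c). (a, c)).
      measure (cond (distr \<Phi> borel swap) ac) B = measure (cond \<mu> (fst ac)) B"
    by (simp only: distr_ac)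
  from AE_distrD[OF _ this] show ?thesis by (simp add: case_prod_beta')
qed

lemma integral_product:
  fixes u :: "'b \<Rightarrow> real" and G :: "'a \<times> 'c \<Rightarrow> real"
  assumes u: "u \<in> borel_measurable borel" "\<And>y. \<bar>u y\<bar> \<le> D" and G: "G \<in> borel_measurable borel" "\<And>x. \<bar>G x\<bar> \<le> C"
  shows "(\<integral>x. u (fst (snd x)) * G (fst x, snd (snd x)) \<partial>\<Phi>) = (\<integral>ac. (\<integral>y. u y \<partial>cond \<mu> (fst ac)) * G ac \<partial>\<nu>)"
proof -
  have "(\<integral>x. u (fst (snd x)) * G (fst x, snd (snd x)) \<partial>\<Phi>) = (\<integral>p. u (snd p) * G (fst p) \<partial>distr \<Phi> borel swap)"
    using u(1) G(1) by (subst integral_distr) (auto simp: case_prod_beta')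
  also have "\<dots> = (\<integral>ac. (\<integral>y. u y \<partial>cond \<mu> (fst ac)) * G ac \<partial>\<nu>)"
    using disintegration_integral[OF swap_probs is_rcd_swap G(1) u(1) G(2) u(2)] by (simp add: marg_swap)
  finally show ?thesis .
qed

end

section \<open>Kernel averages in the topology of information\<close>

lemma abs_integral_probs_le:
  fixes u :: "'y::topological_space \<Rightarrow> real"
  assumes \<zeta>: "\<zeta> \<in> probs euclidean" and u: "\<And>y. \<bar>u y\<bar> \<le> D" "continuous_on UNIV u"
  shows "\<bar>\<integral>y. u y \<partial>\<zeta>\<bar> \<le> D"
proof -
  interpret prob_space \<zeta> using probsD[OF \<zeta>] by simp
  note [measurable_cong] = probsD(2)[OF \<zeta>]
  have [measurable]: "u \<in> borel_measurable borel" using u(2) by (rule borel_measurable_continuous_onI)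
  have "0 \<le> D" using u(1)[of undefined] by linarith
  have "\<bar>\<integral>y. u y \<partial>\<zeta>\<bar> \<le> (\<integral>y. \<bar>u y\<bar> \<partial>\<zeta>)" by (rule integral_abs_bound)
  also have "\<dots> \<le> (\<integral>y. D \<partial>\<zeta>)"
    using u(1) \<open>0 \<le> D\<close> by (intro integral_mono integrable_const_bound[of _ D]) auto
  also have "\<dots> = D" using probsD[OF \<zeta>] by simp
  finally show ?thesis .
qed

text \<open>\<open>psi \<mu>\<close> is the law of \<open>(a, cond \<mu> a)\<close>, so a change of
  variables makes the integral a \<open>psi \<mu>\<close>-expectation of \<open>F\<close>. The
  kernel enters \<open>F\<close> only as a point \<open>\<zeta>\<close> of the weak space, where its
  average of \<open>u\<close> is continuous.\<close>

lemma continuous_map_infoT_kernel_distance: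
  fixes u :: "'b::polish_space \<Rightarrow> real" and h :: "'a::polish_space \<Rightarrow> real"
  assumes u: "continuous_on UNIV u" "bounded (range u)" and h: "continuous_on UNIV h" "bounded (range h)"
  shows "continuous_map infoT euclideanreal (\<lambda>\<mu>. \<integral>a. \<bar>(\<integral>y. u y \<partial>cond \<mu> a) - h a\<bar> \<partial>marg \<mu>)"
proof -
  define F where "F = (\<lambda>(a :: 'a, \<zeta> :: 'b measure). \<bar>(\<integral>y. u y \<partial>\<zeta>) - h a\<bar>)"
  let ?X = "prod_topology (euclidean :: 'a topology) (weakT (euclidean :: 'b topology))"
  obtain D H where D: "\<And>y. \<bar>u y\<bar> \<le> D" and H: "\<And>a. \<bar>h a\<bar> \<le> H"
    using u(2) h(2) by (auto simp: bounded_iff)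
  have "continuous_map (weakT euclidean) euclideanreal (\<lambda>\<zeta>. \<integral>y. u y \<partial>\<zeta>)"
    using u by (intro continuous_map_weakT_integral) auto
  then have "continuous_map ?X euclideanreal (\<lambda>p. \<integral>y. u y \<partial>snd p)"
    using continuous_map_compose[OF continuous_map_snd] by (fastforce simp: comp_def)
  moreover have "continuous_map ?X euclideanreal (\<lambda>p. h (fst p))"
    using continuous_map_compose[OF continuous_map_fst, of euclidean euclideanreal h] h(1) by (simp add: comp_def)
  ultimately have F: "continuous_map ?X euclideanreal F"
    unfolding F_def case_prod_beta' by (intro continuous_intros)
  \<comment> \<open>The bound holds on the carrier only: it needs \<open>\<zeta>\<close> to be a
    probability measure.\<close>
  have "bounded (F ` topspace ?X)"
  proof -
    have "\<bar>F p\<bar> \<le> D + H" if "p \<in> topspace ?X" for p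
    proof -
      have "snd p \<in> probs euclidean" using that by auto
      from abs_integral_probs_le[OF this D u(1)] H[of "fst p"] show ?thesis
        by (auto simp: F_def case_prod_beta')
    qed
    then show ?thesis unfolding bounded_iff by (intro exI[of _ "D + H"]) auto
  qed
  from continuous_map_weakT_integral[OF F this]
  have "continuous_map infoT euclideanreal (\<lambda>\<mu>. \<integral>p. F p \<partial>psi \<mu>)"
    unfolding infoT_def using continuous_map_pullback[of _ _ "\<lambda>M. \<integral>p. F p \<partial>M" _ psi]
    by (simp add: comp_def)
  moreover have "(\<integral>p. F p \<partial>psi \<mu>) = (\<integral>a. \<bar>(\<integral>y. u y \<partial>cond \<mu> a) - h a\<bar> \<partial>marg \<mu>)"
    if "\<mu> \<in> topspace infoT" for \<mu> :: "('a \<times> 'b) measure"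
  proof -
    have \<mu>: "\<mu> \<in> probs euclidean" using that by (simp add: infoT_def topspace_pullback_topology)
    have "cond \<mu> \<in> borel \<rightarrow>\<^sub>M borel_of (weakT euclidean)"
      using is_rcd_cond[OF \<mu>] by (simp add: is_rcd_def)
    then have "(\<lambda>a. (a, cond \<mu> a)) \<in> marg \<mu> \<rightarrow>\<^sub>M borel_of ?X"
      by (intro measurable_Pair_borel_of second_countable_euclidean second_countable_weakT)
         (simp_all cong: measurable_cong_sets)
    moreover have "F \<in> borel_measurable (borel_of ?X)"
      using continuous_map_measurable_borel_of[OF F] by simp
    ultimately show ?thesis unfolding psi_def by (subst integral_distr) (auto simp: F_def)
  qed
  ultimately show ?thesis by (rule continuous_map_eq)
qed

section \<open>Product functions exhausting an open set\<close>

text \<open>Countably many basic boxes, with one side in the \<open>(a, c)\<close> space and one in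
  the \<open>b\<close> space, lie inside \<open>W\<close> and cover it. Each box contributes
  products of two tents of equal steepness. Vanishing off \<open>W\<close> keeps the later
  approximation below the indicator, and the exact value 1 makes it reach the indicator.\<close>

lemma box_tents:
  fixes W :: "('a::polish_space \<times> 'b::polish_space \<times> 'c::polish_space) set"
  assumes W: "open W"
  shows "\<exists>(u :: nat \<Rightarrow> 'b \<Rightarrow> real) (G :: nat \<Rightarrow> 'a \<times> 'c \<Rightarrow> real).
    (\<forall>k. continuous_on UNIV (u k) \<and> (\<forall>y. 0 \<le> u k y \<and> u k y \<le> 1) \<and>
         continuous_on UNIV (G k) \<and> (\<forall>z. 0 \<le> G k z \<and> G k z \<le> 1)) \<and>
    (\<forall>x. x \<notin> W \<longrightarrow> (\<forall>k. u k (fst (snd x)) * G k (fst x, snd (snd x)) = 0)) \<and>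
    (\<forall>x\<in>W. \<exists>k. u k (fst (snd x)) * G k (fst x, snd (snd x)) = 1)"
proof -
  obtain BA :: "('a \<times> 'c) set set" where BA: "countable BA" "topological_basis BA"
    using ex_countable_basis by blast
  obtain BB :: "'b set set" where BB: "countable BB" "topological_basis BB"
    using ex_countable_basis by blast
  \<comment> \<open>The triple with empty sets satisfies the inclusion vacuously and keeps
    \<open>J\<close> nonempty for the enumeration, even when no basic box fits into
    \<open>W\<close>.\<close>
  define J where "J = insert ({}, {}, 0 :: nat) {(U, V, j) \<in> BA \<times> BB \<times> UNIV.
      \<forall>x. (fst x, snd (snd x)) \<in> U \<longrightarrow> fst (snd x) \<in> V \<longrightarrow> x \<in> W}"
  have "countable J"
    unfolding J_def
    by (intro countable_insert countable_subset[OF _ countable_SIGMA[OF BA(1) countable_SIGMA[OF BB(1)]]]) auto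
  define s where "s = from_nat_into J"
  have range_s: "range s = J" unfolding s_def using \<open>countable J\<close>
    by (intro range_from_nat_into) (auto simp: J_def)
  have J: "x \<in> W" if "(U, V, j) \<in> J" "(fst x, snd (snd x)) \<in> U" "fst (snd x) \<in> V" for U V j x
    using that by (cases x) (auto simp: J_def)
  define u where "u k = (case s k of (U, V, j) \<Rightarrow> tent V j)" for k
  define G where "G k = (case s k of (U, V, j) \<Rightarrow> tent U j)" for k
  have regular: "continuous_on UNIV (u k) \<and> (\<forall>y. 0 \<le> u k y \<and> u k y \<le> 1) \<and>
         continuous_on UNIV (G k) \<and> (\<forall>z. 0 \<le> G k z \<and> G k z \<le> 1)" for k
    by (cases "s k") (auto simp: u_def G_def tent_range continuous_on_tent)
  have zero: "u k (fst (snd x)) * G k (fst x, snd (snd x)) = 0" if "x \<notin> W" for x k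
  proof -
    obtain U V j where s: "s k = (U, V, j)" by (cases "s k") auto
    then have "(U, V, j) \<in> J" using range_s by (metis rangeI)
    then have "(fst x, snd (snd x)) \<notin> U \<or> fst (snd x) \<notin> V" using J that by blast
    then show ?thesis by (auto simp: u_def G_def s tent_eq_0)
  qed
  have one: "\<exists>k. u k (fst (snd x)) * G k (fst x, snd (snd x)) = 1" if "x \<in> W" for x
  proof -
    let ?r = "\<lambda>p :: ('a \<times> 'c) \<times> 'b. (fst (fst p), snd p, snd (fst p))"
    have "open (?r -` W)" using W by (intro open_vimage) (auto intro!: continuous_intros)
    moreover have "((fst x, snd (snd x)), fst (snd x)) \<in> ?r -` W" using that by simp
    ultimately obtain U0 V0 where UV: "open U0" "open V0"
      "((fst x, snd (snd x)), fst (snd x)) \<in> U0 \<times> V0" "U0 \<times> V0 \<subseteq> ?r -` W"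
      by (rule open_prod_elim)
    then have 0: "open U0" "open V0" "(fst x, snd (snd x)) \<in> U0" "fst (snd x) \<in> V0" "U0 \<times> V0 \<subseteq> ?r -` W"
      by auto
    obtain U where U: "U \<in> BA" "(fst x, snd (snd x)) \<in> U" "U \<subseteq> U0"
      using topological_basisE[OF BA(2) 0(1,3)] by blast
    obtain V where V: "V \<in> BB" "fst (snd x) \<in> V" "V \<subseteq> V0"
      using topological_basisE[OF BB(2) 0(2,4)] by blast
    obtain i where i: "\<And>j. i \<le> j \<Longrightarrow> tent U j (fst x, snd (snd x)) = 1"
      using tent_eventually_1[OF topological_basis_open[OF BA(2) U(1)] U(2)] by blast
    obtain i' where i': "\<And>j. i' \<le> j \<Longrightarrow> tent V j (fst (snd x)) = 1"
      using tent_eventually_1[OF topological_basis_open[OF BB(2) V(1)] V(2)] by blast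
    have "y \<in> W" if "(fst y, snd (snd y)) \<in> U" "fst (snd y) \<in> V" for y
    proof -
      have "((fst y, snd (snd y)), fst (snd y)) \<in> ?r -` W"
        using that U(3) V(3) 0(5) by blast
      then show ?thesis by simp
    qed
    then have "(U, V, max i i') \<in> J" unfolding J_def using U(1) V(1) by simp
    then obtain k where "s k = (U, V, max i i')" using range_s by (metis imageE)
    then show ?thesis using i[of "max i i'"] i'[of "max i i'"] by (intro exI[of _ k]) (simp add: u_def G_def)
  qed
  show ?thesis
    by (intro exI[of _ u] exI[of _ G] conjI; intro allI ballI impI; (rule regular | erule zero | erule one))
qed

lemma continuous_on_coordinates:
  fixes w :: "'b::topological_space \<Rightarrow> real" and E :: "'a::topological_space \<times> 'c::topological_space \<Rightarrow> real"
  shows "continuous_on UNIV w \<Longrightarrow> continuous_on UNIV (\<lambda>x :: 'a \<times> 'b \<times> 'c. w (fst (snd x)))"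
    and "continuous_on UNIV E \<Longrightarrow> continuous_on UNIV (\<lambda>x :: 'a \<times> 'b \<times> 'c. E (fst x, snd (snd x)))"
  by (erule continuous_on_compose2; auto intro!: continuous_intros)+

section \<open>Continuity on the set of consistent pairs\<close>

locale glueing =
  fixes P :: "(('a::polish_space \<times> 'b::polish_space) measure \<times> ('a \<times> 'c::polish_space) measure) set"
    and \<phi> :: "('a \<times> 'b) measure \<times> ('a \<times> 'c) measure \<Rightarrow> ('a \<times> 'b \<times> 'c) measure"
  assumes product: "\<And>p. p \<in> P \<Longrightarrow> conditional_product (fst p) (snd p) (\<phi> p)"
begin

abbreviation "X \<equiv> subtopology (prod_topology infoT (weakT euclidean)) P"

lemma topspace_X: "p \<in> topspace X \<Longrightarrow> p \<in> P"
  by simp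

lemma continuous_map_X:
  "continuous_map X infoT fst" "continuous_map X (weakT euclidean) snd"
  by (auto intro: continuous_map_from_subtopology continuous_map_fst continuous_map_snd)

text \<open>The conditional expectation \<open>U \<mu> a\<close> of \<open>u\<close> given \<open>a\<close> is only measurable in \<open>a\<close>, so
  weak convergence of \<open>\<nu>\<close> does not apply to it. At a fixed base point it is approximated in
  the mean by a continuous \<open>h\<close>; the error is the integral under \<open>psi \<mu>\<close> of a continuous
  function of \<open>(a, \<zeta>)\<close> and hence stays small near the base point in the topology of information.\<close>

lemma continuous_map_integral_product:
  fixes u :: "'b \<Rightarrow> real" and G :: "'a \<times> 'c \<Rightarrow> real"
  assumes u: "continuous_on UNIV u" "bounded (range u)" and G: "continuous_on UNIV G" "bounded (range G)"
  shows "continuous_map X euclideanreal (\<lambda>p. \<integral>x. u (fst (snd x)) * G (fst x, snd (snd x)) \<partial>\<phi> p)"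
    (is "continuous_map X euclideanreal ?T")
proof -
  obtain D where D: "\<And>y. \<bar>u y\<bar> \<le> D" using u(2) by (auto simp: bounded_iff)
  obtain C0 where C0: "\<And>z. \<bar>G z\<bar> \<le> C0" using G(2) by (auto simp: bounded_iff)
  \<comment> \<open>Strict positivity allows the tolerance \<open>e / (4 * C)\<close> below.\<close>
  define C where "C = C0 + 1"
  have C: "\<bar>G z\<bar> \<le> C" for z using C0[of z] by (simp add: C_def)
  have "0 < C" using C0[of undefined] by (simp add: C_def)
  have [measurable]: "u \<in> borel_measurable borel" "G \<in> borel_measurable borel"
    using u(1) G(1) by (auto intro: borel_measurable_continuous_onI)
  define U where "U \<mu> a = (\<integral>y. u y \<partial>cond \<mu> a)" for \<mu> :: "('a \<times> 'b) measure" and a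
  define S where "S h \<mu> = (\<integral>a. \<bar>U \<mu> a - h a\<bar> \<partial>marg \<mu>)" for h and \<mu> :: "('a \<times> 'b) measure"
  define J where "J h \<nu> = (\<integral>ac. h (fst ac) * G ac \<partial>\<nu>)" for h and \<nu> :: "('a \<times> 'c) measure"
  have U_meas: "U \<mu> \<in> borel_measurable borel" and U_le: "\<And>a. \<bar>U \<mu> a\<bar> \<le> D"
    if \<mu>: "\<mu> \<in> probs euclidean" for \<mu> :: "('a \<times> 'b) measure"
  proof -
    note K = is_rcd_prob_algebra[OF is_rcd_cond[OF \<mu>]]
    show "U \<mu> \<in> borel_measurable borel"
      unfolding U_def using integral_measurable_subprob_algebra[of u borel] measurable_prob_algebraD[OF K]
      by (simp add: measurable_compose)
    show "\<bar>U \<mu> a\<bar> \<le> D" for a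
      unfolding U_def using abs_integral_probs_le[OF prob_algebra_probs[OF K] D u(1)] by simp
  qed
  \<comment> \<open>The estimate holds at every \<open>p\<close> of \<open>P\<close> with the same
    \<open>h\<close>, so it can be used both at the base point and near it. Consistency turns the
    \<open>\<nu>\<close>-integral of the error, a function of \<open>a\<close> alone, into the
    integral over the marginal of \<open>\<mu>\<close> that defines \<open>S\<close>.\<close>
  have T_J: "\<bar>?T p - J h (snd p)\<bar> \<le> C * S h (fst p)"
    if p: "p \<in> P" and h: "continuous_on UNIV h" "bounded (range h)" for p h
  proof -
    interpret conditional_product "fst p" "snd p" "\<phi> p" using product[OF p] .
    obtain H where H: "\<And>a. \<bar>h a\<bar> \<le> H" using h(2) by (auto simp: bounded_iff)
    note [measurable] = U_meas[OF \<mu>]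
    have [measurable]: "h \<in> borel_measurable borel" using h(1) by (rule borel_measurable_continuous_onI)
    have bnd: "\<bar>U (fst p) a - h a\<bar> \<le> D + H" for a using U_le[OF \<mu>, of a] H[of a] by linarith
    have nn: "0 \<le> D" "0 \<le> H" "0 \<le> C" using D[of undefined] H[of undefined] C[of undefined] by linarith+
    have int1: "integrable (snd p) (\<lambda>ac. U (fst p) (fst ac) * G ac)"
      using U_le[OF \<mu>] C nn by (intro \<nu>.integrable_const_bound[of _ "D * C"]) (auto simp: abs_mult intro!: mult_mono)
    have int2: "integrable (snd p) (\<lambda>ac. h (fst ac) * G ac)"
      using H C nn by (intro \<nu>.integrable_const_bound[of _ "H * C"]) (auto simp: abs_mult intro!: mult_mono)
    have int3: "integrable (snd p) (\<lambda>ac. C * \<bar>U (fst p) (fst ac) - h (fst ac)\<bar>)"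
      using bnd nn by (intro integrable_mult_right \<nu>.integrable_const_bound[of _ "D + H"]) auto
    have "?T p = (\<integral>ac. U (fst p) (fst ac) * G ac \<partial>snd p)"
      unfolding U_def by (rule integral_product[OF _ D _ C]) simp_all
    then have "\<bar>?T p - J h (snd p)\<bar> = \<bar>\<integral>ac. (U (fst p) (fst ac) - h (fst ac)) * G ac \<partial>snd p\<bar>"
      using int1 int2 by (simp add: J_def left_diff_distrib)
    also have "\<dots> \<le> (\<integral>ac. \<bar>(U (fst p) (fst ac) - h (fst ac)) * G ac\<bar> \<partial>snd p)"
      by (rule integral_abs_bound)
    also have "\<dots> \<le> (\<integral>ac. C * \<bar>U (fst p) (fst ac) - h (fst ac)\<bar> \<partial>snd p)"
    proof (rule integral_mono[OF _ int3])
      show "integrable (snd p) (\<lambda>ac. \<bar>(U (fst p) (fst ac) - h (fst ac)) * G ac\<bar>)"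
        using int1 int2 by (simp add: left_diff_distrib)
      show "\<bar>(U (fst p) (fst ac) - h (fst ac)) * G ac\<bar> \<le> C * \<bar>U (fst p) (fst ac) - h (fst ac)\<bar>" for ac
        using mult_left_mono[OF C[of ac], of "\<bar>U (fst p) (fst ac) - h (fst ac)\<bar>"]
        by (simp add: abs_mult mult.commute)
    qed
    also have "\<dots> = C * (\<integral>ac. \<bar>U (fst p) (fst ac) - h (fst ac)\<bar> \<partial>snd p)" by simp
    also have "(\<integral>ac. \<bar>U (fst p) (fst ac) - h (fst ac)\<bar> \<partial>snd p) = S h (fst p)"
      unfolding S_def consistent unfolding marg_def by (subst integral_distr) auto
    finally show ?thesis .
  qed
  show ?thesis
    unfolding continuous_map_atin limitin_canonical_iff
  proof (intro ballI tendstoI)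
    fix p0 and e :: real assume p0: "p0 \<in> topspace X" and e: "0 < e"
    interpret p0: conditional_product "fst p0" "snd p0" "\<phi> p0" using product[OF topspace_X[OF p0]] .
    interpret m: prob_space "marg (fst p0)" using probsD[OF marg_probs[OF p0.\<mu>]] by simp
    have "integrable (marg (fst p0)) (U (fst p0))"
      using U_meas[OF p0.\<mu>] U_le[OF p0.\<mu>] by (intro m.integrable_const_bound[of _ D]) auto
    \<comment> \<open>Multiplied by \<open>C\<close>, the error is below \<open>e / 4\<close> at the
      base point and, by continuity of \<open>S h\<close>, nearby; the remaining
      \<open>e / 2\<close> goes to the variation of \<open>J h\<close>.\<close>
    moreover have e': "0 < e / (4 * C)" using e \<open>0 < C\<close> by simp
    ultimately obtain h where h: "continuous_on UNIV h" "bounded (range h)" and Sh: "S h (fst p0) < e / (4 * C)"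
      using continuous_dense_L1[OF marg_probs[OF p0.\<mu>]] unfolding S_def by blast
    have "continuous_map infoT euclideanreal (S h)"
      unfolding S_def U_def using u h by (rule continuous_map_infoT_kernel_distance)
    from continuous_map_compose[OF continuous_map_X(1) this]
    have "((\<lambda>p. S h (fst p)) \<longlongrightarrow> S h (fst p0)) (atin X p0)"
      using p0 unfolding continuous_map_atin limitin_canonical_iff comp_def by blast
    from order_tendstoD(2)[OF this Sh] have ev1: "\<forall>\<^sub>F p in atin X p0. S h (fst p) < e / (4 * C)" .
    have "continuous_map (weakT euclidean) euclideanreal (J h)"
      unfolding J_def
    proof (rule continuous_map_weakT_integral)
      show "continuous_map euclidean euclideanreal (\<lambda>ac. h (fst ac) * G ac)"
        using G(1) by (auto intro!: continuous_intros continuous_on_compose2[OF h(1)])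
      obtain H where H: "\<And>a. \<bar>h a\<bar> \<le> H" using h(2) by (auto simp: bounded_iff)
      then have "0 \<le> H" by (meson abs_ge_zero order_trans)
      with H C show "bounded ((\<lambda>ac. h (fst ac) * G ac) ` topspace euclidean)"
        by (auto simp: bounded_iff abs_mult intro!: exI[of _ "H * C"] mult_mono)
    qed
    from continuous_map_compose[OF continuous_map_X(2) this]
    have "((\<lambda>p. J h (snd p)) \<longlongrightarrow> J h (snd p0)) (atin X p0)"
      using p0 unfolding continuous_map_atin limitin_canonical_iff comp_def by blast
    from tendstoD[OF this, of "e / 2"] e
    have ev2: "\<forall>\<^sub>F p in atin X p0. dist (J h (snd p)) (J h (snd p0)) < e / 2" by simp
    have "\<forall>\<^sub>F p in atin X p0. p \<in> topspace X"
      using p0 by (rule eventually_atin_topspace)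
    with ev1 ev2 show "\<forall>\<^sub>F p in atin X p0. dist (?T p) (?T p0) < e"
    proof eventually_elim
      case (elim p)
      have "C * S h (fst p) < e / 4" "C * S h (fst p0) < e / 4"
        using elim(1) Sh \<open>0 < C\<close> by (simp_all add: field_simps)
      then show ?case
        using T_J[OF topspace_X[OF elim(3)] h] T_J[OF topspace_X[OF p0] h] elim(2)
        unfolding dist_real_def by linarith
    qed
  qed
qed

text \<open>Expanding the product of the \<open>1 - u k * G k\<close> one factor at a time only produces integrals of products, because
  products of product functions are again product functions.\<close>

lemma continuous_map_integral_complement_product:
  fixes u :: "nat \<Rightarrow> 'b \<Rightarrow> real" and G :: "nat \<Rightarrow> 'a \<times> 'c \<Rightarrow> real"
  assumes u: "\<And>k. continuous_on UNIV (u k)" "\<And>k y. 0 \<le> u k y" "\<And>k y. u k y \<le> 1"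
    and G: "\<And>k. continuous_on UNIV (G k)" "\<And>k z. 0 \<le> G k z" "\<And>k z. G k z \<le> 1"
    and v: "continuous_on UNIV v" "\<And>y. 0 \<le> v y" "\<And>y. v y \<le> 1"
    and F: "continuous_on UNIV F" "\<And>z. 0 \<le> F z" "\<And>z. F z \<le> 1"
  shows "continuous_map X euclideanreal (\<lambda>p. \<integral>x. v (fst (snd x)) * F (fst x, snd (snd x)) *
    (\<Prod>k<m. 1 - u k (fst (snd x)) * G k (fst x, snd (snd x))) \<partial>\<phi> p)"
  using v F
\<comment> \<open>Splitting off factor \<open>m\<close> replaces \<open>v\<close> and
  \<open>F\<close> by their products with \<open>u m\<close> and \<open>G m\<close>, so both must
  vary in the induction.\<close>
proof (induction m arbitrary: v F)
  case 0
  then have "bounded (range v)" "bounded (range F)" by (auto simp: bounded_iff intro!: exI[of _ 1])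
  with 0 show ?case using continuous_map_integral_product[of v F] by simp
next
  case (Suc m)
  define R where "R x = (\<Prod>k<m. 1 - u k (fst (snd x)) * G k (fst x, snd (snd x)))" for x :: "'a \<times> 'b \<times> 'c"
  have uG: "0 \<le> u k y * G k z" "u k y * G k z \<le> 1" for k y z
    by (intro mult_nonneg_nonneg mult_le_one u G)+
  have R: "0 \<le> R x" "R x \<le> 1" for x
    unfolding R_def using uG by (auto intro!: prod_nonneg prod_le_1)
  have R_cont: "continuous_on UNIV R"
    unfolding R_def using u(1) G(1) by (intro continuous_intros continuous_on_coordinates)
  have split: "(\<integral>x. v (fst (snd x)) * F (fst x, snd (snd x)) *
      (\<Prod>k<Suc m. 1 - u k (fst (snd x)) * G k (fst x, snd (snd x))) \<partial>\<phi> p) =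
    (\<integral>x. v (fst (snd x)) * F (fst x, snd (snd x)) * R x \<partial>\<phi> p) -
    (\<integral>x. (v (fst (snd x)) * u m (fst (snd x))) * (F (fst x, snd (snd x)) * G m (fst x, snd (snd x))) * R x \<partial>\<phi> p)"
    if p: "p \<in> topspace X" for p
  proof -
    interpret conditional_product "fst p" "snd p" "\<phi> p" using product[OF topspace_X[OF p]] .
    have int: "integrable (\<phi> p) (\<lambda>x. w (fst (snd x)) * E (fst x, snd (snd x)) * R x)"
      if w: "continuous_on UNIV w" "\<And>y. 0 \<le> w y \<and> w y \<le> 1" and E: "continuous_on UNIV E" "\<And>z. 0 \<le> E z \<and> E z \<le> 1"
      for w :: "'b \<Rightarrow> real" and E :: "'a \<times> 'c \<Rightarrow> real"
    proof (rule \<Phi>.integrable_const_bound[of _ 1])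
      have "0 \<le> w (fst (snd x)) * E (fst x, snd (snd x)) * R x \<and> w (fst (snd x)) * E (fst x, snd (snd x)) * R x \<le> 1" for x
        using w(2) E(2) R[of x] by (auto intro!: mult_le_one mult_nonneg_nonneg)
      then show "AE x in \<phi> p. norm (w (fst (snd x)) * E (fst x, snd (snd x)) * R x) \<le> 1" by auto
      have "continuous_on UNIV (\<lambda>x. w (fst (snd x)) * E (fst x, snd (snd x)) * R x)"
        using w(1) E(1) by (intro continuous_intros continuous_on_coordinates R_cont)
      from borel_measurable_continuous_onI[OF this]
      show "(\<lambda>x. w (fst (snd x)) * E (fst x, snd (snd x)) * R x) \<in> borel_measurable (\<phi> p)"
        by (simp cong: measurable_cong_sets)
    qed
    have 1: "integrable (\<phi> p) (\<lambda>x. v (fst (snd x)) * F (fst x, snd (snd x)) * R x)"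
      using Suc.prems by (intro int) auto
    have 2: "integrable (\<phi> p) (\<lambda>x. (v (fst (snd x)) * u m (fst (snd x))) *
        (F (fst x, snd (snd x)) * G m (fst x, snd (snd x))) * R x)"
      using Suc.prems u G by (intro int[of "\<lambda>y. v y * u m y" "\<lambda>z. F z * G m z"]) (auto intro!: continuous_intros mult_le_one)
    show ?thesis
      unfolding Bochner_Integration.integral_diff[OF 1 2, symmetric]
      by (intro Bochner_Integration.integral_cong) (simp_all add: R_def algebra_simps)
  qed
  have 1: "continuous_map X euclideanreal (\<lambda>p. \<integral>x. v (fst (snd x)) * F (fst x, snd (snd x)) * R x \<partial>\<phi> p)"
    unfolding R_def by (rule Suc.IH) (use Suc.prems in auto)
  have 2: "continuous_map X euclideanreal (\<lambda>p. \<integral>x. (v (fst (snd x)) * u m (fst (snd x))) *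
      (F (fst x, snd (snd x)) * G m (fst x, snd (snd x))) * R x \<partial>\<phi> p)"
    unfolding R_def using Suc.prems u G
    by (intro Suc.IH[of "\<lambda>y. v y * u m y" "\<lambda>z. F z * G m z"]) (auto intro!: continuous_intros mult_le_one)
  from continuous_map_diff[OF 1 2]
  show ?case by (rule continuous_map_eq) (simp only: split)
qed

text \<open>The functions \<open>1 - R m\<close> stay below the indicator of \<open>W\<close> and
  converge to it pointwise. Hence \<open>measure (\<phi> p) W\<close> is the supremum over
  \<open>m\<close> of functions continuous in \<open>p\<close>, and the set is a union of open
  sets.\<close>

lemma openin_measure_open:
  assumes W: "open W"
  shows "openin X {p \<in> topspace X. t < measure (\<phi> p) W}"
proof -
  obtain u :: "nat \<Rightarrow> 'b \<Rightarrow> real" and G :: "nat \<Rightarrow> 'a \<times> 'c \<Rightarrow> real"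
    where uG: "\<And>k. continuous_on UNIV (u k) \<and> (\<forall>y. 0 \<le> u k y \<and> u k y \<le> 1) \<and>
         continuous_on UNIV (G k) \<and> (\<forall>z. 0 \<le> G k z \<and> G k z \<le> 1)"
      and out: "\<And>x k. x \<notin> W \<Longrightarrow> u k (fst (snd x)) * G k (fst x, snd (snd x)) = 0"
      and ins: "\<And>x. x \<in> W \<Longrightarrow> \<exists>k. u k (fst (snd x)) * G k (fst x, snd (snd x)) = 1"
    using box_tents[OF W] by metis
  define R where "R m x = (\<Prod>k<m. 1 - u k (fst (snd x)) * G k (fst x, snd (snd x)))" for m and x :: "'a \<times> 'b \<times> 'c"
  have R01: "0 \<le> R m x" "R m x \<le> 1" for m x
    unfolding R_def using uG by (auto intro!: prod_nonneg prod_le_1 mult_le_one)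
  have R_out: "R m x = 1" if "x \<notin> W" for m x unfolding R_def by (simp only: out[OF that]) simp
  have R_cont: "continuous_on UNIV (R m)" for m
    unfolding R_def using uG by (intro continuous_intros continuous_on_coordinates) auto
  \<comment> \<open>The two factors 1 are the initial constant functions \<open>v\<close> and
    \<open>F\<close> of the expansion.\<close>
  have "continuous_map X euclideanreal (\<lambda>p. \<integral>x. 1 * 1 * R m x \<partial>\<phi> p)" for m
    unfolding R_def using uG by (intro continuous_map_integral_complement_product) auto
  then have cont: "continuous_map X euclideanreal (\<lambda>p. 1 - (\<integral>x. R m x \<partial>\<phi> p))" for m
    by (auto intro!: continuous_intros)
  have eq: "{p \<in> topspace X. t < measure (\<phi> p) W} = (\<Union>m. {p \<in> topspace X. 1 - (\<integral>x. R m x \<partial>\<phi> p) \<in> {t<..}})"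
  proof -
    have "t < measure (\<phi> p) W \<longleftrightarrow> (\<exists>m. t < 1 - (\<integral>x. R m x \<partial>\<phi> p))" if p: "p \<in> topspace X" for p
    proof -
      interpret conditional_product "fst p" "snd p" "\<phi> p" using product[OF topspace_X[OF p]] .
      have [measurable]: "W \<in> sets borel" "R m \<in> borel_measurable borel" for m
        using W R_cont by (auto intro: borel_measurable_continuous_onI)
      have int: "integrable (\<phi> p) (R m)" for m
        using R01 by (intro \<Phi>.integrable_const_bound[of _ 1]) auto
      have one: "measure (\<phi> p) UNIV = 1" using \<Phi>.prob_space by simp
      have I: "1 - (\<integral>x. R m x \<partial>\<phi> p) = (\<integral>x. 1 - R m x \<partial>\<phi> p)" for m
        using int by (simp add: one)
      have le: "1 - (\<integral>x. R m x \<partial>\<phi> p) \<le> measure (\<phi> p) W" for m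
      proof -
        have "(\<integral>x. 1 - R m x \<partial>\<phi> p) \<le> (\<integral>x. indicator W x \<partial>\<phi> p)"
        proof (rule integral_mono)
          show "integrable (\<phi> p) (\<lambda>x. 1 - R m x)" using int by simp
          show "integrable (\<phi> p) (indicator W :: _ \<Rightarrow> real)"
            by (intro \<Phi>.integrable_const_bound[of _ 1]) auto
          show "1 - R m x \<le> indicator W x" for x
            using R01(1)[of m x] R_out[of x m] by (cases "x \<in> W") auto
        qed
        then show ?thesis by (simp only: I) simp
      qed
      have "(\<lambda>m. \<integral>x. 1 - R m x \<partial>\<phi> p) \<longlonglongrightarrow> (\<integral>x. indicator W x \<partial>\<phi> p)"
      proof (rule integral_dominated_convergence[where w = "\<lambda>_. 1"])
        have "(\<lambda>m. 1 - R m x) \<longlonglongrightarrow> indicator W x" for x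
        proof (cases "x \<in> W")
          case True
          then obtain k where k: "u k (fst (snd x)) * G k (fst x, snd (snd x)) = 1" using ins by blast
          \<comment> \<open>The product runs over indices below \<open>m\<close>, so the vanishing
            factor \<open>k\<close> is present from \<open>m = k + 1\<close> on.\<close>
          have "R m x = 0" if "k < m" for m
            unfolding R_def using that k by (intro prod_zero) auto
          then have "\<forall>\<^sub>F m in sequentially. 1 - R m x = indicator W x"
            using True by (intro eventually_sequentiallyI[of "Suc k"]) simp
          then show ?thesis by (rule tendsto_eventually)
        qed (simp add: R_out)
        then show "AE x in \<phi> p. (\<lambda>m. 1 - R m x) \<longlonglongrightarrow> indicator W x" by simp
        show "AE x in \<phi> p. norm (1 - R m x) \<le> 1" for m using R01[of m] by (auto simp: abs_le_iff)
      qed simp_all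
      then have lim: "(\<lambda>m. 1 - (\<integral>x. R m x \<partial>\<phi> p)) \<longlonglongrightarrow> measure (\<phi> p) W" by (simp only: I) simp
      have "\<exists>m. t < 1 - (\<integral>x. R m x \<partial>\<phi> p)" if "t < measure (\<phi> p) W"
        using eventually_happens'[OF _ order_tendstoD(1)[OF lim that]] by simp
      then show ?thesis using le by (meson less_le_trans)
    qed
    then show ?thesis by auto
  qed
  show ?thesis unfolding eq
    by (intro openin_Union) (use cont in \<open>auto simp: continuous_map_def simp del: greaterThan_iff\<close>)
qed

lemma continuous_map_glueing: "continuous_map X (weakT euclidean) \<phi>"
proof (rule portmanteau_open[OF _ openin_measure_open])
  fix p assume "p \<in> topspace X"
  then interpret conditional_product "fst p" "snd p" "\<phi> p" using product[OF topspace_X] by blast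
  show "\<phi> p \<in> probs euclidean" by (rule \<Phi>)
qed

end

theorem theorem1:
  fixes P :: "(('a::polish_space \<times> 'b::polish_space) measure \<times> ('a \<times> 'c::polish_space) measure) set"
    and \<phi> :: "('a \<times> 'b) measure \<times> ('a \<times> 'c) measure \<Rightarrow> ('a \<times> 'b \<times> 'c) measure"
  assumes P_sub: "P \<subseteq> {(\<mu>, \<nu>). \<mu> \<in> probs euclidean \<and> \<nu> \<in> probs euclidean \<and> marg \<mu> = marg \<nu>}"
    and phi_prob: "\<And>p. p \<in> P \<Longrightarrow> \<phi> p \<in> probs euclidean"
    and phi_rect: "\<And>\<mu> \<nu> A B C. (\<mu>, \<nu>) \<in> P \<Longrightarrow> A \<in> sets borel \<Longrightarrow> B \<in> sets borel \<Longrightarrow> C \<in> sets borel \<Longrightarrow>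
        measure (\<phi> (\<mu>, \<nu>)) (A \<times> B \<times> C) = (LINT ac:(A \<times> C)|\<nu>. measure (cond \<mu> (fst ac)) B)"
  shows "continuous_map (subtopology (prod_topology infoT (weakT euclidean)) P) (weakT euclidean) \<phi> \<and>
    (\<forall>\<mu> \<nu> B. (\<mu>, \<nu>) \<in> P \<longrightarrow> B \<in> sets borel \<longrightarrow>
        (AE abc in \<phi> (\<mu>, \<nu>).
          measure (cond (distr (\<phi> (\<mu>, \<nu>)) borel (\<lambda>(a, b, c). ((a, c), b))) (fst abc, snd (snd abc))) B
            = measure (cond (distr (\<phi> (\<mu>, \<nu>)) borel (\<lambda>(a, b, c). (a, b))) (fst abc)) B
          \<and> measure (cond (distr (\<phi> (\<mu>, \<nu>)) borel (\<lambda>(a, b, c). (a, b))) (fst abc)) B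
            = measure (cond \<mu> (fst abc)) B))"
proof -
  have product: "conditional_product (fst p) (snd p) (\<phi> p)" if "p \<in> P" for p
  proof
    show "fst p \<in> probs euclidean" "snd p \<in> probs euclidean" "marg (fst p) = marg (snd p)"
      using P_sub that by auto
    show "\<phi> p \<in> probs euclidean" using phi_prob that .
    show "measure (\<phi> p) (A \<times> B \<times> C) = (LINT ac:(A \<times> C)|snd p. measure (cond (fst p) (fst ac)) B)"
      if "A \<in> sets borel" "B \<in> sets borel" "C \<in> sets borel" for A B C
      using phi_rect[of "fst p" "snd p" A B C] \<open>p \<in> P\<close> that by simp
  qed
  interpret glueing P \<phi> by (rule glueing.intro) (rule product)
  show ?thesis
  proof (intro conjI continuous_map_glueing allI impI)
    fix \<mu> \<nu> B assume "(\<mu>, \<nu>) \<in> P" and B: "B \<in> sets (borel :: 'b measure)"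
    then interpret conditional_product \<mu> \<nu> "\<phi> (\<mu>, \<nu>)" using product[of "(\<mu>, \<nu>)"] by simp
    show "AE abc in \<phi> (\<mu>, \<nu>).
          measure (cond (distr (\<phi> (\<mu>, \<nu>)) borel (\<lambda>(a, b, c). ((a, c), b))) (fst abc, snd (snd abc))) B
            = measure (cond (distr (\<phi> (\<mu>, \<nu>)) borel (\<lambda>(a, b, c). (a, b))) (fst abc)) B
          \<and> measure (cond (distr (\<phi> (\<mu>, \<nu>)) borel (\<lambda>(a, b, c). (a, b))) (fst abc)) B
            = measure (cond \<mu> (fst abc)) B"
      \<comment> \<open>After rewriting the law of \<open>(a, b)\<close> to \<open>\<mu>\<close>,
        the second equality is reflexive and the first is the statement about conditioning on
        \<open>(a, c)\<close>.\<close>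
      unfolding distr_ab using conditional_independence[OF B] by simp
  qed
qed

end
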